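(* Let $M\ge1$, let $X=[c,+\infty)$ with $c\ge 0$, let $S\subset(0,+\infty)$ be an interval, and let $P$ be a positive Borel measure on $S$ such that $\int_S(1+|s|)^{4M}e^{-2cs}\,dP(s)<+\infty$. If $\psi(x,s)=e^{-xs}$ and $\operatorname{card}(\operatorname{supp}P)\ge 2M$, then in the reconstruction framework defined by $P$ and $\psi$: (1) If $m_0=\sum_{i=1}^Ma_i\delta_{x_i}$ with $x_1<\dots<x_M$ in the interior of $X$ and $a_i>0$ for all $i$, then $m_0$ satisfies the Non-Degenerate Source Condition. (2) If $x_0$ is in the interior of $X$, then the point $x_0$ is $(2M-1)$ Non Degenerate.
   Context: The reconstruction framework defined by $P$ and $\psi$ is: $H=L^2(S,P)$ and $\varphi:X\to H$, $\varphi(x)=\psi(x,\cdot)$. $C_0(X)$ is the space of continuous functions $\eta:X\to\mathbb{R}$ such that for every $\varepsilon>0$ there is a compact $K\subset X$ with $|\eta|\le\varepsilon$ on $X\setminus K$. For $k\in\mathbb{N}$, $\mathcal{K}^k(X;H)$ is the set of $\varphi\in C^k(X;H)$ such that $x\mapsto\langle p,\varphi(x)\rangle_H$ belongs to $C_0(X)$ for all $p\in H$ and $\sup_{x\in X}\|\varphi^{(i)}(x)\|_H<\infty$ for $0\le i\le k$. For $p\in H$, $(\Phi^*p)(x)=\langle\varphi(x),p\rangle_H$. $\Gamma_x:\mathbb{R}^{2M}\to H$ is $\Gamma_xb=\sum_{i=1}^M(b_{2i-1}\varphi(x_i)+b_{2i}\varphi'(x_i))$. If $\Gamma_x$ has full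 rank (is injective), $p_V$ is the element of minimal norm of $\{p\in H:(\Phi^*p)(x_i)=1,\ (\Phi^*p)'(x_i)=0,\ 1\le i\le M\}$ and $\eta_V=\Phi^*p_V$. The measure $m_0$ satisfies the Non-Degenerate Source Condition if $\Gamma_x$ has full rank, $\eta_V(x)<1$ for all $x\in X\setminus\{x_1,\dots,x_M\}$, and $\eta_V''(x_i)<0$ for all $1\le i\le M$. $F_{2M-1}:\mathbb{R}^{2M}\to H$ is $F_{2M-1}b=\sum_{k=0}^{2M-1}b_{k+1}\varphi^{(k)}(x_0)$. If it has full rank (is injective), $p_W$ is the element of minimal norm of $\{p\in H:(\Phi^*p)(x_0)=1,\ (\Phi^*p)^{(k)}(x_0)=0,\ 1\le k\le2M-1\}$ and $\eta_W=\Phi^*p_W$. The point $x_0$ is $(2M-1)$ Non Degenerate if $\varphi\in\mathcal{K}^{2M}(X;H)$, $F_{2M-1}$ has full rank, $\eta_W^{(2M)}(x_0)<0$, and $\eta_W(x)<1$ for all $x\in X\setminus\{x_0\}$. *)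

theory Defs
  imports "HOL-Analysis.Analysis"
begin

section \<open>The Hilbert space \<open>L\<^sup>2(S, P)\<close>\<close>

text \<open>
  The measure \<open>P\<close> carries its underlying set, \<open>S = space P\<close>. Elements of \<open>L\<^sup>2(S, P)\<close> are
  handled through representatives: square integrable functions, two of which are the same element
  iff they agree \<open>P\<close>-almost everywhere. All notions below that evaluate an element of
  \<open>L\<^sup>2(S, P)\<close> depend on it only up to \<open>P\<close>-almost everywhere equality.
\<close>

definition L2 :: "real measure \<Rightarrow> (real \<Rightarrow> real) set" where
  "L2 P = {f \<in> borel_measurable P. integrable P (\<lambda>s. (f s)\<^sup>2)}"

definition L2_eq :: "real measure \<Rightarrow> (real \<Rightarrow> real) \<Rightarrow> (real \<Rightarrow> real) \<Rightarrow> bool" where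
  "L2_eq P f g \<longleftrightarrow> (AE s in P. f s = g s)"

definition L2_inner :: "real measure \<Rightarrow> (real \<Rightarrow> real) \<Rightarrow> (real \<Rightarrow> real) \<Rightarrow> real" where
  "L2_inner P f g = (LINT s|P. f s * g s)"

definition L2_norm :: "real measure \<Rightarrow> (real \<Rightarrow> real) \<Rightarrow> real" where
  "L2_norm P f = sqrt (L2_inner P f f)"

text \<open>
  Maps \<open>X \<rightarrow> L\<^sup>2(S, P)\<close> are curried functions of \<open>x\<close> and \<open>s\<close>. Derivatives are limits of
  difference quotients in the \<open>L\<^sup>2\<close> norm; they are one-sided at boundary points of \<open>X\<close>.
  The membership conditions are needed because \<^const>\<open>L2_norm\<close> is only meaningful on \<^const>\<open>L2\<close>.
\<close>

definition has_L2_deriv ::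
  "real measure \<Rightarrow> real set \<Rightarrow> (real \<Rightarrow> real \<Rightarrow> real) \<Rightarrow> (real \<Rightarrow> real) \<Rightarrow> real \<Rightarrow> bool" where
  "has_L2_deriv P X \<phi> D x \<longleftrightarrow>
     (\<forall>y\<in>X. \<phi> y \<in> L2 P) \<and> D \<in> L2 P \<and>
     ((\<lambda>y. L2_norm P (\<lambda>s. (\<phi> y s - \<phi> x s) / (y - x) - D s)) \<longlongrightarrow> 0) (at x within X)"

definition L2_deriv ::
  "real measure \<Rightarrow> real set \<Rightarrow> (real \<Rightarrow> real \<Rightarrow> real) \<Rightarrow> real \<Rightarrow> real \<Rightarrow> real" where
  "L2_deriv P X \<phi> x = (SOME D. has_L2_deriv P X \<phi> D x)"

abbreviation L2_derivs ::
  "real measure \<Rightarrow> real set \<Rightarrow> nat \<Rightarrow> (real \<Rightarrow> real \<Rightarrow> real) \<Rightarrow> real \<Rightarrow> real \<Rightarrow> real" where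
  "L2_derivs P X k \<phi> \<equiv> (L2_deriv P X ^^ k) \<phi>"

definition L2_continuous_on ::
  "real measure \<Rightarrow> real set \<Rightarrow> (real \<Rightarrow> real \<Rightarrow> real) \<Rightarrow> bool" where
  "L2_continuous_on P X \<phi> \<longleftrightarrow>
     (\<forall>x\<in>X. \<phi> x \<in> L2 P) \<and>
     (\<forall>x\<in>X. ((\<lambda>y. L2_norm P (\<lambda>s. \<phi> y s - \<phi> x s)) \<longlongrightarrow> 0) (at x within X))"

definition L2_Ck :: "real measure \<Rightarrow> real set \<Rightarrow> nat \<Rightarrow> (real \<Rightarrow> real \<Rightarrow> real) set" where
  "L2_Ck P X k = {\<phi>.
     (\<forall>i<k. \<forall>x\<in>X. \<exists>D. has_L2_deriv P X (L2_derivs P X i \<phi>) D x) \<and>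
     L2_continuous_on P X (L2_derivs P X k \<phi>)}"


section \<open>Admissible reconstruction frameworks\<close>

definition C0 :: "real set \<Rightarrow> (real \<Rightarrow> real) set" where
  "C0 X = {\<eta>. continuous_on X \<eta> \<and>
     (\<forall>\<epsilon>>0. \<exists>K\<subseteq>X. compact K \<and> (\<forall>x\<in>X - K. \<bar>\<eta> x\<bar> \<le> \<epsilon>))}"

definition admissible :: "real measure \<Rightarrow> real set \<Rightarrow> nat \<Rightarrow> (real \<Rightarrow> real \<Rightarrow> real) set" where
  "admissible P X k = {\<phi> \<in> L2_Ck P X k.
     (\<forall>p\<in>L2 P. (\<lambda>x. L2_inner P p (\<phi> x)) \<in> C0 X) \<and>
     (\<forall>i\<le>k. bdd_above ((\<lambda>x. L2_norm P (L2_derivs P X i \<phi> x)) ` X))}"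

text \<open>The map \<open>x \<mapsto> \<psi>(x, \<cdot>)\<close> into \<open>L\<^sup>2(S, P)\<close>.\<close>

definition framework :: "(real \<times> real \<Rightarrow> real) \<Rightarrow> real \<Rightarrow> real \<Rightarrow> real" where
  "framework \<psi> x = (\<lambda>s. \<psi> (x, s))"

definition Phi_adj ::
  "real measure \<Rightarrow> (real \<Rightarrow> real \<Rightarrow> real) \<Rightarrow> (real \<Rightarrow> real) \<Rightarrow> real \<Rightarrow> real" where
  "Phi_adj P \<phi> p x = L2_inner P (\<phi> x) p"

text \<open>Iterated derivatives of a real-valued function on \<open>X\<close>, one-sided at boundary points.\<close>

abbreviation derivs_within :: "real set \<Rightarrow> nat \<Rightarrow> (real \<Rightarrow> real) \<Rightarrow> real \<Rightarrow> real" where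
  "derivs_within X k \<eta> \<equiv> ((\<lambda>f x. vector_derivative f (at x within X)) ^^ k) \<eta>"

text \<open>
  Linear maps \<open>\<real>\<^sup>n \<rightarrow> L\<^sup>2(S, P)\<close> take coefficient vectors \<open>b\<close> indexed by \<open>1, \<dots>, n\<close>; the
  other values of \<open>b\<close> are irrelevant. Full rank means injectivity.
\<close>

definition full_rank ::
  "real measure \<Rightarrow> nat \<Rightarrow> ((nat \<Rightarrow> real) \<Rightarrow> real \<Rightarrow> real) \<Rightarrow> bool" where
  "full_rank P n G \<longleftrightarrow> (\<forall>b b'. L2_eq P (G b) (G b') \<longrightarrow> (\<forall>j\<in>{1..n}. b j = b' j))"


section \<open>Vanishing derivatives precertificate and the Non-Degenerate Source Condition\<close>

definition Gamma_op ::
  "real measure \<Rightarrow> real set \<Rightarrow> (real \<Rightarrow> real \<Rightarrow> real) \<Rightarrow> nat \<Rightarrow> (nat \<Rightarrow> real) \<Rightarrow>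
   (nat \<Rightarrow> real) \<Rightarrow> real \<Rightarrow> real" where
  "Gamma_op P X \<phi> M x b =
     (\<lambda>s. \<Sum>i\<in>{1..M}. b (2 * i - 1) * \<phi> (x i) s + b (2 * i) * L2_deriv P X \<phi> (x i) s)"

definition p_V ::
  "real measure \<Rightarrow> real set \<Rightarrow> (real \<Rightarrow> real \<Rightarrow> real) \<Rightarrow> nat \<Rightarrow> (nat \<Rightarrow> real) \<Rightarrow> real \<Rightarrow> real" where
  "p_V P X \<phi> M x = arg_min (L2_norm P) (\<lambda>p. p \<in> L2 P \<and>
     (\<forall>i\<in>{1..M}. Phi_adj P \<phi> p (x i) = 1 \<and> derivs_within X 1 (Phi_adj P \<phi> p) (x i) = 0))"

definition eta_V ::
  "real measure \<Rightarrow> real set \<Rightarrow> (real \<Rightarrow> real \<Rightarrow> real) \<Rightarrow> nat \<Rightarrow> (nat \<Rightarrow> real) \<Rightarrow> real \<Rightarrow> real" where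
  "eta_V P X \<phi> M x = Phi_adj P \<phi> (p_V P X \<phi> M x)"

text \<open>The measure \<open>\<Sum>\<^sub>i a\<^sub>i \<delta>\<^sub>x\<^sub>i\<close> (\<open>1 \<le> i \<le> M\<close>) on the Borel sets of \<open>X\<close>, as the image under
  \<open>i \<mapsto> x\<^sub>i\<close> of the measure with point masses \<open>a\<^sub>i\<close>.\<close>

definition dirac_sum :: "real set \<Rightarrow> nat \<Rightarrow> (nat \<Rightarrow> real) \<Rightarrow> (nat \<Rightarrow> real) \<Rightarrow> real measure" where
  "dirac_sum X M a x =
     distr (point_measure {1..M} (\<lambda>i. ennreal (a i))) (restrict_space borel X) x"

definition ndsc_at ::
  "real measure \<Rightarrow> real set \<Rightarrow> (real \<Rightarrow> real \<Rightarrow> real) \<Rightarrow> nat \<Rightarrow> (nat \<Rightarrow> real) \<Rightarrow> bool" where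
  "ndsc_at P X \<phi> M x \<longleftrightarrow>
     full_rank P (2 * M) (Gamma_op P X \<phi> M x) \<and>
     (\<forall>y\<in>X - x ` {1..M}. eta_V P X \<phi> M x y < 1) \<and>
     (\<forall>i\<in>{1..M}. derivs_within X 2 (eta_V P X \<phi> M x) (x i) < 0)"

text \<open>
  The condition is a property of the discrete measure \<open>m\<^sub>0\<close>. The increasing enumeration of its
  atoms is unique, so the condition may be read off from any such representation; see
  \<open>ndsc_dirac_sum_iff\<close> below.
\<close>

definition non_degenerate_source_condition ::
  "real measure \<Rightarrow> real set \<Rightarrow> (real \<Rightarrow> real \<Rightarrow> real) \<Rightarrow> real measure \<Rightarrow> bool" where
  "non_degenerate_source_condition P X \<phi> m\<^sub>0 \<longleftrightarrow>
     (\<exists>M a x. strict_mono_on {1..M} x \<and> x ` {1..M} \<subseteq> X \<and> (\<forall>i\<in>{1..M}. 0 < a i) \<and>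
        m\<^sub>0 = dirac_sum X M a x \<and> ndsc_at P X \<phi> M x)"


section \<open>Non degenerate points\<close>

text \<open>Everything in this section is indexed by \<open>M\<close>, the order being \<open>2M - 1\<close>.\<close>

definition F_op ::
  "real measure \<Rightarrow> real set \<Rightarrow> (real \<Rightarrow> real \<Rightarrow> real) \<Rightarrow> nat \<Rightarrow> real \<Rightarrow>
   (nat \<Rightarrow> real) \<Rightarrow> real \<Rightarrow> real" where
  "F_op P X \<phi> M x\<^sub>0 b = (\<lambda>s. \<Sum>k\<in>{0..<2 * M}. b (k + 1) * L2_derivs P X k \<phi> x\<^sub>0 s)"

definition p_W ::
  "real measure \<Rightarrow> real set \<Rightarrow> (real \<Rightarrow> real \<Rightarrow> real) \<Rightarrow> nat \<Rightarrow> real \<Rightarrow> real \<Rightarrow> real" where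
  "p_W P X \<phi> M x\<^sub>0 = arg_min (L2_norm P) (\<lambda>p. p \<in> L2 P \<and>
     Phi_adj P \<phi> p x\<^sub>0 = 1 \<and>
     (\<forall>k\<in>{1..2 * M - 1}. derivs_within X k (Phi_adj P \<phi> p) x\<^sub>0 = 0))"

definition eta_W ::
  "real measure \<Rightarrow> real set \<Rightarrow> (real \<Rightarrow> real \<Rightarrow> real) \<Rightarrow> nat \<Rightarrow> real \<Rightarrow> real \<Rightarrow> real" where
  "eta_W P X \<phi> M x\<^sub>0 = Phi_adj P \<phi> (p_W P X \<phi> M x\<^sub>0)"

definition non_degenerate_point ::
  "real measure \<Rightarrow> real set \<Rightarrow> (real \<Rightarrow> real \<Rightarrow> real) \<Rightarrow> nat \<Rightarrow> real \<Rightarrow> bool" where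
  "non_degenerate_point P X \<phi> M x\<^sub>0 \<longleftrightarrow>
     \<phi> \<in> admissible P X (2 * M) \<and>
     full_rank P (2 * M) (F_op P X \<phi> M x\<^sub>0) \<and>
     derivs_within X (2 * M) (eta_W P X \<phi> M x\<^sub>0) x\<^sub>0 < 0 \<and>
     (\<forall>x\<in>X - {x\<^sub>0}. eta_W P X \<phi> M x\<^sub>0 x < 1)"


section \<open>Support of a measure\<close>

text \<open>The support relative to \<open>space P\<close>.\<close>

definition measure_supp :: "real measure \<Rightarrow> real set" where
  "measure_supp P = {s \<in> space P. \<forall>U. open U \<and> s \<in> U \<longrightarrow> emeasure P (U \<inter> space P) > 0}"


section \<open>Uniqueness of the representation of a discrete measure\<close>

lemma emeasure_dirac_sum_singleton:
  assumes "x ` {1..M} \<subseteq> X" "\<forall>i\<in>{1..M}. 0 < a i" "t \<in> X"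
  shows "emeasure (dirac_sum X M a x) {t} = (\<Sum>i\<in>{i\<in>{1..M}. x i = t}. ennreal (a i))"
proof -
  have m: "x \<in> measurable (point_measure {1..M} (\<lambda>i. ennreal (a i))) (restrict_space borel X)"
    using assms(1) by (auto simp: measurable_point_measure_eq1 space_restrict_space)
  have s: "{t} \<in> sets (restrict_space borel X)"
    using assms(3) by (auto simp: sets_restrict_space intro!: image_eqI[where x="{t}"])
  have eq: "x -` {t} \<inter> space (point_measure {1..M} (\<lambda>i. ennreal (a i))) = {i\<in>{1..M}. x i = t}"
    by (auto simp: space_point_measure)
  show ?thesis
    unfolding dirac_sum_def emeasure_distr[OF m s] eq
    by (rule emeasure_point_measure_finite) auto
qed

lemma atoms_dirac_sum:
  assumes "x ` {1..M} \<subseteq> X" "\<forall>i\<in>{1..M}. 0 < a i"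
  shows "{t\<in>X. emeasure (dirac_sum X M a x) {t} \<noteq> 0} = x ` {1..M}"
proof -
  have "emeasure (dirac_sum X M a x) {t} \<noteq> 0 \<longleftrightarrow> t \<in> x ` {1..M}" if "t \<in> X" for t
  proof -
    have "(\<Sum>i\<in>{i\<in>{1..M}. x i = t}. ennreal (a i)) = 0 \<longleftrightarrow> (\<forall>i\<in>{i\<in>{1..M}. x i = t}. a i \<le> 0)"
      by (subst sum_eq_0_iff) (auto simp: ennreal_eq_0_iff)
    then show ?thesis
      unfolding emeasure_dirac_sum_singleton[OF assms that] using assms(2) by force
  qed
  with assms(1) show ?thesis by blast
qed

lemma strict_mono_on_image_unique:
  fixes x y :: "nat \<Rightarrow> real"
  assumes x: "strict_mono_on {1..M} x" and y: "strict_mono_on {1..N} y"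
    and eq: "x ` {1..M} = y ` {1..N}"
  shows "M = N" "\<forall>i\<in>{1..M}. x i = y i"
proof -
  have l: "sorted_list_of_set (z ` {1..K}) = map z [1..<Suc K]"
    if z: "strict_mono_on {1..K} z" for z :: "nat \<Rightarrow> real" and K
  proof -
    have "sorted_wrt (<) (map z [1..<Suc K])"
      using z unfolding sorted_wrt_map strict_mono_on_def
      by (auto simp: sorted_wrt_iff_nth_less simp del: upt_Suc)
    then have "sorted_list_of_set (set (map z [1..<Suc K])) = map z [1..<Suc K]"
      by (intro sorted_list_of_set.idem_if_sorted_distinct)
         (auto simp: strict_sorted_iff simp del: upt_Suc)
    then show ?thesis
      by (simp add: atLeastLessThanSuc_atLeastAtMost del: upt_Suc)
  qed
  have m: "map x [1..<Suc M] = map y [1..<Suc N]"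
    using l[OF x] l[OF y] eq by simp
  from arg_cong[OF m, of length] show MN: "M = N" by (simp del: upt_Suc)
  show "\<forall>i\<in>{1..M}. x i = y i"
    using m unfolding MN by (auto simp: map_eq_conv simp del: upt_Suc)
qed

lemma ndsc_at_cong:
  assumes "\<forall>i\<in>{1..M}. x i = y i"
  shows "ndsc_at P X \<phi> M x = ndsc_at P X \<phi> M y"
proof -
  have "Gamma_op P X \<phi> M x = Gamma_op P X \<phi> M y"
    using assms by (auto simp: Gamma_op_def fun_eq_iff intro!: sum.cong)
  moreover have "p_V P X \<phi> M x = p_V P X \<phi> M y"
    unfolding p_V_def using assms by (intro arg_cong[where f="arg_min _"] ext) auto
  ultimately show ?thesis
    using assms image_cong[of "{1..M}" "{1..M}" x y] by (simp add: ndsc_at_def eta_V_def)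
qed

lemma ndsc_dirac_sum_iff:
  assumes "strict_mono_on {1..M} x" "x ` {1..M} \<subseteq> X" "\<forall>i\<in>{1..M}. 0 < a i"
  shows "non_degenerate_source_condition P X \<phi> (dirac_sum X M a x) \<longleftrightarrow> ndsc_at P X \<phi> M x"
proof
  assume "non_degenerate_source_condition P X \<phi> (dirac_sum X M a x)"
  then obtain N b y where y: "strict_mono_on {1..N} y" "y ` {1..N} \<subseteq> X" "\<forall>i\<in>{1..N}. 0 < b i"
    and eq: "dirac_sum X M a x = dirac_sum X N b y" and n: "ndsc_at P X \<phi> N y"
    unfolding non_degenerate_source_condition_def by blast
  have "x ` {1..M} = y ` {1..N}"
    using atoms_dirac_sum[OF assms(2,3)] atoms_dirac_sum[OF y(2,3)] eq by simp
  from strict_mono_on_image_unique[OF assms(1) y(1) this] n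
  show "ndsc_at P X \<phi> M x"
    using ndsc_at_cong[of M x y] by auto
next
  assume "ndsc_at P X \<phi> M x"
  with assms show "non_degenerate_source_condition P X \<phi> (dirac_sum X M a x)"
    unfolding non_degenerate_source_condition_def by blast
qed

end

theory Submission
  imports Defs "HOL-Computational_Algebra.Polynomial" "HOL-Real_Asymp.Real_Asymp"
begin

text \<open>
  The derivatives of the kernel are \<open>(-s)\<^sup>k exp (-xs)\<close>, so both precertificates have the form
  \<open>\<eta> x = \<integral> exp (-xs) p s dP\<close> with an exponential polynomial \<open>p\<close> (a Gram matrix argument), and
  by Rolle's theorem a nonzero exponential polynomial with \<open>n\<close> coefficients has fewer than \<open>n\<close>
  real zeros, counting double zeros twice. This gives full rank. It also shows that \<open>1 - \<eta>\<close> has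
  no zeros beyond the \<open>2M\<close> prescribed ones. Otherwise the functional \<open>g \<mapsto> g 0 - \<integral> g p dP\<close> would
  vanish on the \<open>2M + 1\<close> dimensional space spanned by the corresponding \<open>(-s)\<^sup>k exp (-xs)\<close>. This
  space contains a nonzero \<open>g\<close> that vanishes at \<open>0\<close>, at the at most \<open>2M - 1\<close> sign changes of \<open>p\<close> on
  \<open>s > 0\<close>, and at points \<open>s < 0\<close> making up a total of \<open>2M\<close>; these are then all zeros of \<open>g\<close> and they
  are simple. Hence \<open>g p\<close> has constant sign on \<open>s > 0\<close> and integral \<open>0\<close>, so \<open>P\<close> is carried by the
  zeros of \<open>p\<close>, which are fewer than \<open>2M\<close>. Finally, all zeros of \<open>1 - \<eta>\<close> have even order and
  \<open>1 - \<eta>\<close> tends to \<open>1\<close> at infinity, which determines the signs.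
\<close>

section \<open>Zeros of exponential polynomials\<close>

text \<open>Rolle's theorem gives a zero of \<open>F'\<close> strictly between any two consecutive
  points of \<open>A\<close>. These zeros lie outside \<open>A\<close>, so they are distinct from
  the points of \<open>B\<close>, which mark double zeros of \<open>F\<close>.\<close>

lemma rolle_card:
  fixes F F' :: "real \<Rightarrow> real"
  assumes A: "finite A" "\<forall>t\<in>A. F t = 0" and B: "B \<subseteq> A" "\<forall>t\<in>B. F' t = 0"
    and deriv: "\<And>t. (F has_real_derivative F' t) (at t)"
  obtains C where "finite C" "\<forall>t\<in>C. F' t = 0" "card A + card B \<le> Suc (card C)"
proof (cases "A = {}")
  case True
  with B(1) have "card A + card B \<le> Suc (card ({} :: real set))" by simp
  then show ?thesis using that[of "{}"] by blast
next
  case False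
  \<comment> \<open>\<open>A'\<close> consists of the points of \<open>A\<close> that have a
    successor in \<open>A\<close>, namely \<open>nxt a\<close>.\<close>
  define A' where "A' = A - {Max A}"
  define nxt where "nxt a = Min {b\<in>A. a < b}" for a
  have nxt: "nxt a \<in> A" "a < nxt a" and nxt_le: "\<And>b. b \<in> A \<Longrightarrow> a < b \<Longrightarrow> nxt a \<le> b"
    if "a \<in> A'" for a
  proof -
    have "a < Max A" using that A False unfolding A'_def by (simp add: order.strict_iff_order)
    then have "{b\<in>A. a < b} \<noteq> {}" using A False Max_in by blast
    then have "nxt a \<in> {b\<in>A. a < b}" unfolding nxt_def using A by (intro Min_in) auto
    then show "nxt a \<in> A" "a < nxt a" by auto
    show "nxt a \<le> b" if "b \<in> A" "a < b" for b
      unfolding nxt_def using A that by (intro Min_le) auto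
  qed
  have "\<exists>z. a < z \<and> z < nxt a \<and> F' z = 0" if a: "a \<in> A'" for a
  proof -
    have "a \<in> A" using a by (simp add: A'_def)
    then have "F a = F (nxt a)" using A nxt[OF a] by simp
    moreover have "continuous_on {a..nxt a} F"
      using deriv by (meson DERIV_isCont continuous_at_imp_continuous_on)
    ultimately obtain z where "a < z" "z < nxt a" "DERIV F z :> 0"
      using Rolle[of a "nxt a" F] nxt[OF a] deriv real_differentiable_def by blast
    then show ?thesis using deriv DERIV_unique by metis
  qed
  then obtain r where r: "\<And>a. a \<in> A' \<Longrightarrow> a < r a \<and> r a < nxt a \<and> F' (r a) = 0" by metis
  have notin: "r a \<notin> A" if "a \<in> A'" for a using r[OF that] nxt_le[OF that] by force
  have less: "r a < r b" if "a \<in> A'" "b \<in> A'" "a < b" for a b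
    using r[OF that(1)] r[OF that(2)] nxt_le[OF that(1), of b] that by (force simp: A'_def)
  have "inj_on r A'"
    using less by (metis inj_onI less_irrefl linorder_neqE_linordered_idom)
  then have "card (r ` A') = card A - 1" using A False by (simp add: card_image A'_def)
  moreover have "card (r ` A' \<union> B) = card (r ` A') + card B"
    using A B notin by (intro card_Un_disjoint) (auto simp: A'_def dest: finite_subset)
  moreover have "finite (r ` A' \<union> B)" using A B by (auto simp: A'_def dest: finite_subset)
  ultimately show ?thesis
    using that[of "r ` A' \<union> B"] r B A False by (auto simp: card_gt_0_iff)
qed

definition exp_poly :: "real set \<Rightarrow> (real \<Rightarrow> real poly) \<Rightarrow> real \<Rightarrow> real" where
  "exp_poly \<Lambda> p t = (\<Sum>l\<in>\<Lambda>. poly (p l) t * exp (l * t))"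

text \<open>The number of available coefficients. The case split is needed because
  \<open>degree 0 = 0\<close>: a frequency whose polynomial has become zero must contribute
  nothing.\<close>

definition exp_poly_dim :: "real set \<Rightarrow> (real \<Rightarrow> real poly) \<Rightarrow> nat" where
  "exp_poly_dim \<Lambda> p = (\<Sum>l\<in>\<Lambda>. if p l = 0 then 0 else Suc (degree (p l)))"

lemma exp_poly_has_derivative:
  "(exp_poly \<Lambda> p has_real_derivative exp_poly \<Lambda> (\<lambda>l. pderiv (p l) + smult l (p l)) t) (at t)"
  unfolding exp_poly_def[abs_def]
  by (auto intro!: derivative_eq_intros sum.cong simp: algebra_simps)

text \<open>The derivative has lower degree, so the leading coefficient of \<open>p\<close>
  survives, multiplied by \<open>a\<close>.\<close>

lemma pderiv_plus_smult_nonzero: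
  fixes p :: "real poly"
  assumes "p \<noteq> 0" "a \<noteq> 0"
  shows "pderiv p + smult a p \<noteq> 0" "degree (pderiv p + smult a p) \<le> degree p"
proof -
  have "coeff (pderiv p) (degree p) = 0"
    by (simp add: coeff_pderiv coeff_eq_0)
  then have "coeff (pderiv p + smult a p) (degree p) \<noteq> 0" using assms by simp
  then show "pderiv p + smult a p \<noteq> 0" by (metis coeff_0)
  show "degree (pderiv p + smult a p) \<le> degree p"
    by (rule degree_add_le) (auto simp: degree_pderiv degree_smult_le)
qed

text \<open>Induction on the number of coefficients. The factor \<open>exp (- l0 * t)\<close> keeps
  simple and double zeros and shifts the frequency \<open>l0\<close> to 0. Differentiation then
  removes at least one coefficient at \<open>l0\<close> and adds none elsewhere, while Rolle's
  theorem loses only one zero.\<close>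

lemma exp_poly_zeros:
  assumes "finite \<Lambda>" "l0 \<in> \<Lambda>" "p l0 \<noteq> 0" "finite A" "B \<subseteq> A"
    "\<forall>t\<in>A. exp_poly \<Lambda> p t = 0" "\<forall>t\<in>B. deriv (exp_poly \<Lambda> p) t = 0"
  shows "card A + card B < exp_poly_dim \<Lambda> p"
  using assms
proof (induction "exp_poly_dim \<Lambda> p" arbitrary: p l0 A B rule: less_induct)
  case less
  \<comment> \<open>\<open>p'\<close> gives the derivative of \<open>exp_poly \<Lambda> p\<close>;
    \<open>q\<close> gives \<open>exp (l0 * t)\<close> times the derivative of
    \<open>exp (- l0 * t) * exp_poly \<Lambda> p t\<close>.\<close>
  define q where "q l = pderiv (p l) + smult (l - l0) (p l)" for l
  define p' where "p' l = pderiv (p l) + smult l (p l)" for l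
  have q: "exp_poly \<Lambda> q t = exp_poly \<Lambda> p' t - l0 * exp_poly \<Lambda> p t" for t
    unfolding exp_poly_def q_def p'_def sum_distrib_left sum_subtractf[symmetric]
    by (intro sum.cong) (auto simp: algebra_simps)
  have ql0: "(if q l0 = 0 then 0 else Suc (degree (q l0))) < Suc (degree (p l0))"
    by (auto simp: q_def degree_pderiv pderiv_eq_0_iff)
  have ql: "(if q l = 0 then 0 else Suc (degree (q l))) \<le> (if p l = 0 then 0 else Suc (degree (p l)))"
    if "l \<noteq> l0" for l
    using pderiv_plus_smult_nonzero[of "p l" "l - l0"] that by (auto simp: q_def)
  have dim: "exp_poly_dim \<Lambda> q < exp_poly_dim \<Lambda> p"
    unfolding exp_poly_dim_def
  proof (rule sum_strict_mono_ex1[OF less.prems(1)])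
    show "\<forall>l\<in>\<Lambda>. (if q l = 0 then 0 else Suc (degree (q l))) \<le> (if p l = 0 then 0 else Suc (degree (p l)))"
    proof
      fix l
      show "(if q l = 0 then 0 else Suc (degree (q l))) \<le> (if p l = 0 then 0 else Suc (degree (p l)))"
        by (cases "l = l0") (use ql[of l] ql0 less.prems(3) in \<open>auto split: if_splits\<close>)
    qed
    show "\<exists>l\<in>\<Lambda>. (if q l = 0 then 0 else Suc (degree (q l))) < (if p l = 0 then 0 else Suc (degree (p l)))"
      using ql0 less.prems(2,3) by (intro bexI[of _ l0]) simp_all
  qed
  define F where "F t = exp (- l0 * t) * exp_poly \<Lambda> p t" for t
  define F' where "F' t = exp (- l0 * t) * exp_poly \<Lambda> q t" for t
  have dF: "(F has_real_derivative F' t) (at t)" for t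
    unfolding F_def[abs_def] F'_def q p'_def
    by (rule derivative_eq_intros exp_poly_has_derivative refl | simp add: algebra_simps)+
  have derivp: "deriv (exp_poly \<Lambda> p) t = exp_poly \<Lambda> p' t" for t
    unfolding p'_def by (rule DERIV_imp_deriv[OF exp_poly_has_derivative])
  have F0: "\<forall>t\<in>A. F t = 0" using less.prems(6) by (simp add: F_def)
  have F'0: "\<forall>t\<in>B. F' t = 0"
    using less.prems(5-7) unfolding F'_def q derivp by (auto simp: subset_iff)
  obtain C where C: "finite C" "\<forall>t\<in>C. F' t = 0" "card A + card B \<le> Suc (card C)"
    by (rule rolle_card[OF less.prems(4) F0 less.prems(5) F'0 dF])
  show ?case
  proof (cases "\<exists>l\<in>\<Lambda>. q l \<noteq> 0")
    case True
    then obtain l where "l \<in> \<Lambda>" "q l \<noteq> 0" by blast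
    \<comment> \<open>Double zeros are already accounted for in \<open>C\<close>, so the induction
      hypothesis is used with no double zeros.\<close>
    then have "card C + card ({} :: real set) < exp_poly_dim \<Lambda> q"
      using less.hyps[OF dim less.prems(1), of l C "{}"] C(1,2) by (simp add: F'_def)
    then show ?thesis using C(3) dim by simp
  next
    case False
    \<comment> \<open>If all coefficients of the derivative vanish, only a nonzero multiple of
      \<open>exp (l0 * t)\<close> is left, and it has no zeros.\<close>
    have "p l = 0" if "l \<in> \<Lambda>" "l \<noteq> l0" for l
      using False that pderiv_plus_smult_nonzero(1)[of "p l" "l - l0"] by (auto simp: q_def)
    moreover have "degree (p l0) = 0"
      using False less.prems(2) by (auto simp: q_def pderiv_eq_0_iff)
    then obtain a where "p l0 = [:a:]"
      by (rule degree_eq_zeroE)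
    ultimately have "exp_poly \<Lambda> p t \<noteq> 0" for t
      using less.prems(1-3) by (simp add: exp_poly_def sum.remove[of _ l0])
    then have "A = {}" using less.prems(6) by auto
    then show ?thesis using dim less.prems(5) by simp
  qed
qed

section \<open>Spans of the functions t^k exp(l t) indexed by pairs (l, k)\<close>

text \<open>Pairs as indices let a finite set of pairs describe interpolation conditions: the pair
  \<open>(x, k)\<close> will stand for the derivative of order \<open>k\<close> at the node
  \<open>x\<close>.\<close>

definition monom_exp :: "real \<times> nat \<Rightarrow> real \<Rightarrow> real" where
  "monom_exp i t = t ^ snd i * exp (fst i * t)"

text \<open>Without gaps in the powers, the cardinality bounds the number of zeros. With gaps it
  would not: the single function t, with index \<open>(0, 1)\<close>, has a zero.\<close>

definition down_closed :: "(real \<times> nat) set \<Rightarrow> bool" where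
  "down_closed T \<longleftrightarrow> (\<forall>l k j. (l, k) \<in> T \<longrightarrow> j \<le> k \<longrightarrow> (l, j) \<in> T)"

text \<open>Grouping the pairs by frequency gives an exponential polynomial. By
  \<open>down_closed\<close>, the powers up to the degree at \<open>l\<close> all occur in the fibre
  \<open>K l\<close>, so its dimension is at most \<open>card T\<close>.\<close>

lemma monom_exp_span_zeros:
  assumes T: "finite T" "down_closed T" "i0 \<in> T" "b i0 \<noteq> 0"
    and A: "finite A" "B \<subseteq> A" "\<forall>t\<in>A. (\<Sum>i\<in>T. b i * monom_exp i t) = 0"
      "\<forall>t\<in>B. deriv (\<lambda>t. \<Sum>i\<in>T. b i * monom_exp i t) t = 0"
  shows "card A + card B < card T"
proof -
  define \<Lambda> where "\<Lambda> = fst ` T"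
  define K where "K l = T `` {l}" for l
  define p where "p l = (\<Sum>k\<in>K l. monom (b (l, k)) k)" for l
  have finK: "finite (K l)" for l
    using finite_Image[OF T(1)] by (simp add: K_def)
  have fin\<Lambda>: "finite \<Lambda>" using T by (simp add: \<Lambda>_def)
  have TS: "T = Sigma \<Lambda> K" by (force simp: \<Lambda>_def K_def)
  have cf: "coeff (p l) k = (if k \<in> K l then b (l, k) else 0)" for l k
    using finK by (simp add: p_def coeff_sum)
  have eq: "(\<lambda>t. \<Sum>i\<in>T. b i * monom_exp i t) = exp_poly \<Lambda> p"
  proof
    fix t
    have "(\<Sum>i\<in>T. b i * monom_exp i t) = (\<Sum>l\<in>\<Lambda>. \<Sum>k\<in>K l. b (l, k) * monom_exp (l, k) t)"
      unfolding TS using finK fin\<Lambda> by (simp add: sum.Sigma split_beta)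
    then show "(\<Sum>i\<in>T. b i * monom_exp i t) = exp_poly \<Lambda> p t"
      by (simp add: exp_poly_def p_def poly_sum poly_monom monom_exp_def sum_distrib_right mult.assoc)
  qed
  have "exp_poly_dim \<Lambda> p \<le> (\<Sum>l\<in>\<Lambda>. card (K l))"
    unfolding exp_poly_dim_def
  proof (intro sum_mono)
    fix l
    show "(if p l = 0 then 0 else Suc (degree (p l))) \<le> card (K l)"
    proof (cases "p l = 0")
      case False
      then have "coeff (p l) (degree (p l)) \<noteq> 0" by simp
      then have "degree (p l) \<in> K l" by (auto simp: cf split: if_splits)
      then have "{..degree (p l)} \<subseteq> K l"
        using T(2) unfolding down_closed_def K_def by blast
      then have "card {..degree (p l)} \<le> card (K l)" using finK by (intro card_mono)
      then show ?thesis by simp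
    qed simp
  qed
  also have "\<dots> = card T" unfolding TS using finK fin\<Lambda> by (simp add: card_SigmaI)
  finally have "exp_poly_dim \<Lambda> p \<le> card T" .
  moreover have "fst i0 \<in> \<Lambda>" "p (fst i0) \<noteq> 0"
  proof -
    have "coeff (p (fst i0)) (snd i0) \<noteq> 0" using T by (simp add: cf K_def)
    then show "p (fst i0) \<noteq> 0" by auto
  qed (use T in \<open>simp add: \<Lambda>_def\<close>)
  then have "card A + card B < exp_poly_dim \<Lambda> p"
    using T(1) A unfolding eq by (intro exp_poly_zeros) (auto simp: \<Lambda>_def fun_cong[OF eq])
  ultimately show ?thesis by simp
qed

lemma monom_exp_span_zero_set:
  assumes "finite T" "down_closed T" "i0 \<in> T" "b i0 \<noteq> 0"
  shows "finite {t. (\<Sum>i\<in>T. b i * monom_exp i t) = 0}" (is "finite ?Z")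
    and "card {t. (\<Sum>i\<in>T. b i * monom_exp i t) = 0} < card T"
proof -
  have "card A \<le> card T - 1" if "A \<subseteq> ?Z" "finite A" for A
  proof -
    have "\<forall>t\<in>A. (\<Sum>i\<in>T. b i * monom_exp i t) = 0" using that by blast
    then have "card A + card ({} :: real set) < card T"
      using that by (intro monom_exp_span_zeros[where b = b, OF assms]) auto
    then show ?thesis by simp
  qed
  from finite_if_finite_subsets_card_bdd[of ?Z, OF this]
  show "finite ?Z" "card ?Z < card T"
    using assms(1,3) card_gt_0_iff[of T] by auto
qed

lemma monom_exp_span_has_derivative:
  "((\<lambda>t. \<Sum>i\<in>T. b i * monom_exp i t) has_real_derivative
    deriv (\<lambda>t. \<Sum>i\<in>T. b i * monom_exp i t) t) (at t)"
proof -
  have D: "((\<lambda>t. \<Sum>i\<in>T. b i * monom_exp i t) has_real_derivative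
    (\<Sum>i\<in>T. b i * (real (snd i) * t ^ (snd i - 1) * exp (fst i * t) + t ^ snd i * (exp (fst i * t) * fst i)))) (at t)"
    unfolding monom_exp_def by (auto intro!: derivative_eq_intros sum.cong)
  show ?thesis unfolding DERIV_imp_deriv[OF D] by (rule D)
qed

lemma monom_exp_0: "monom_exp i 0 = 0 ^ snd i"
  by (simp add: monom_exp_def)

section \<open>Linear systems\<close>

text \<open>Gaussian elimination by induction on the equations: a pivot \<open>j0\<close> of
  equation \<open>i0\<close> is eliminated from the others.\<close>

lemma homogeneous_system_nontrivial:
  fixes A :: "'i \<Rightarrow> 'j \<Rightarrow> real"
  assumes "finite I" "finite J" "card I < card J"
  shows "\<exists>b. (\<exists>j\<in>J. b j \<noteq> 0) \<and> (\<forall>i\<in>I. (\<Sum>j\<in>J. b j * A i j) = 0)"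
  using assms
proof (induction I arbitrary: J A rule: finite_induct)
  case empty
  then have "J \<noteq> {}" by auto
  then show ?case by (intro exI[of _ "\<lambda>_. 1"]) auto
next
  case (insert i0 I)
  show ?case
  proof (cases "\<forall>j\<in>J. A i0 j = 0")
    case True
    moreover have "card I < card J" using insert by simp
    ultimately show ?thesis using insert.IH[OF insert.prems(1), of A] by auto
  next
    case False
    then obtain j0 where j0: "j0 \<in> J" "A i0 j0 \<noteq> 0" by blast
    define J' where "J' = J - {j0}"
    have "card I < card J'" "finite J'" using insert j0 by (auto simp: J'_def)
    from insert.IH[OF this(2,1), of "\<lambda>i j. A i j - A i j0 * A i0 j / A i0 j0"]
    obtain b where b: "\<exists>j\<in>J'. b j \<noteq> 0"
      "\<And>i. i \<in> I \<Longrightarrow> (\<Sum>j\<in>J'. b j * (A i j - A i j0 * A i0 j / A i0 j0)) = 0" by blast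
    \<comment> \<open>The value at the pivot is the one that solves equation
      \<open>i0\<close>.\<close>
    define b' where "b' = b(j0 := - (\<Sum>j\<in>J'. b j * A i0 j) / A i0 j0)"
    have s: "(\<Sum>j\<in>J. b' j * A i j) = - (\<Sum>j\<in>J'. b j * A i0 j) / A i0 j0 * A i j0 + (\<Sum>j\<in>J'. b j * A i j)"
      for i
    proof -
      have "(\<Sum>j\<in>J'. b' j * A i j) = (\<Sum>j\<in>J'. b j * A i j)"
        by (intro sum.cong) (auto simp: b'_def J'_def)
      then show ?thesis
        using sum.remove[OF insert.prems(1) j0(1), of "\<lambda>j. b' j * A i j"] by (simp add: b'_def J'_def)
    qed
    have "(\<Sum>j\<in>J. b' j * A i j) = 0" if "i \<in> I" for i
      using b(2)[OF that] unfolding s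
      by (simp add: right_diff_distrib sum_subtractf sum_distrib_left sum_distrib_right sum_divide_distrib
          mult_ac)
    moreover have "(\<Sum>j\<in>J. b' j * A i0 j) = 0" unfolding s using j0 by simp
    moreover have "\<exists>j\<in>J. b' j \<noteq> 0" using b(1) by (auto simp: b'_def J'_def)
    ultimately show ?thesis by blast
  qed
qed

text \<open>The negated right-hand side is added as one more column, with index \<open>None\<close>.
  The enlarged system has a nontrivial solution; by injectivity its weight on the new column is
  nonzero, and dividing by that weight solves the original system.\<close>

lemma square_system_solvable:
  fixes A :: "'i \<Rightarrow> 'j \<Rightarrow> real"
  assumes fin: "finite I" "finite J" "card I = card J"
    and inj: "\<And>b. (\<forall>i\<in>I. (\<Sum>j\<in>J. b j * A i j) = 0) \<Longrightarrow> \<forall>j\<in>J. b j = 0"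
  shows "\<exists>b. \<forall>i\<in>I. (\<Sum>j\<in>J. b j * A i j) = y i"
proof -
  define J' where "J' = insert None (Some ` J)"
  define A' where "A' i j = (case j of None \<Rightarrow> - y i | Some j \<Rightarrow> A i j)" for i j
  have card: "card J' = Suc (card J)"
    using fin by (simp add: J'_def card_image)
  have s: "(\<Sum>j\<in>J'. b j * A' i j) = (\<Sum>j\<in>J. b (Some j) * A i j) - b None * y i" for b i
    using fin by (simp add: J'_def A'_def sum.reindex)
  obtain b where b: "\<exists>j\<in>J'. b j \<noteq> 0" "\<And>i. i \<in> I \<Longrightarrow> (\<Sum>j\<in>J. b (Some j) * A i j) = b None * y i"
  proof -
    have "card I < card J'" "finite J'" using card fin by (auto simp: J'_def)
    from homogeneous_system_nontrivial[OF fin(1) this(2,1), of A']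
    obtain b where b: "\<exists>j\<in>J'. b j \<noteq> 0" "\<forall>i\<in>I. (\<Sum>j\<in>J'. b j * A' i j) = 0" by blast
    from b(2) have "\<forall>i\<in>I. (\<Sum>j\<in>J. b (Some j) * A i j) = b None * y i" unfolding s by simp
    with b(1) that show thesis by blast
  qed
  have "b None \<noteq> 0"
    using inj[of "\<lambda>j. b (Some j)"] b by (auto simp: J'_def)
  then show ?thesis
    using b(2) by (intro exI[of _ "\<lambda>j. b (Some j) / b None"])
      (simp add: sum_divide_distrib[symmetric])
qed

section \<open>Sign changes\<close>

lemma nonzero_constant_sign:
  fixes f :: "real \<Rightarrow> real"
  assumes "connected X" "continuous_on X f" "\<forall>x\<in>X. f x \<noteq> 0"
  shows "(\<forall>x\<in>X. f x > 0) \<or> (\<forall>x\<in>X. f x < 0)"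
proof (rule ccontr)
  assume "\<not> ?thesis"
  then obtain a b where "a \<in> X" "b \<in> X" "f a \<le> 0" "0 \<le> f b" by (auto simp: not_less)
  moreover have "connected (f ` X)" using assms connected_continuous_image by blast
  ultimately have "0 \<in> f ` X" by (meson connectedD_interval imageI)
  then show False using assms by auto
qed

text \<open>The quotient of \<open>f\<close> by \<open>\<Prod>(x - z)\<^sup>n\<close> extends continuously and without zeros to \<open>X\<close>.\<close>

lemma constant_sign_up_to_zeros:
  fixes f A :: "real \<Rightarrow> real"
  assumes X: "connected X" "continuous_on X f" and Z: "finite Z"
    and nz: "\<forall>x\<in>X - Z. f x \<noteq> 0" "\<forall>z\<in>Z. A z \<noteq> 0"
    and lim: "\<And>z. z \<in> Z \<Longrightarrow> ((\<lambda>x. f x / (x - z) ^ n) \<longlongrightarrow> A z) (at z within X)"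
  obtains e :: real where "\<And>x. x \<in> X - Z \<Longrightarrow> e * f x * (\<Prod>z\<in>Z. (x - z) ^ n) > 0"
    "\<And>z. z \<in> X \<inter> Z \<Longrightarrow> e * A z * (\<Prod>y\<in>Z - {z}. (z - y) ^ n) > 0"
proof -
  define h where "h x = (if x \<in> Z then A x / (\<Prod>y\<in>Z - {x}. (x - y) ^ n)
    else f x / (\<Prod>z\<in>Z. (x - z) ^ n))" for x
  have notin: "\<forall>\<^sub>F y in at x within X. y \<notin> Z" for x
    using islimpt_finite[OF Z, of x] filter_leD[OF at_le[OF subset_UNIV]]
    by (auto simp: islimpt_iff_eventually)
  have "(h \<longlongrightarrow> h x) (at x within X)" if x: "x \<in> X" for x
  proof (cases "x \<in> Z")
    case True
    have "((\<lambda>y. f y / (y - x) ^ n / (\<Prod>z\<in>Z - {x}. (y - z) ^ n)) \<longlongrightarrow> A x / (\<Prod>z\<in>Z - {x}. (x - z) ^ n))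
      (at x within X)"
      using Z by (intro tendsto_divide lim True tendsto_prod tendsto_power tendsto_diff) auto
    moreover have "\<forall>\<^sub>F y in at x within X. f y / (y - x) ^ n / (\<Prod>z\<in>Z - {x}. (y - z) ^ n) = h y"
      using notin by eventually_elim (simp add: h_def prod.remove[OF Z True])
    ultimately have "(h \<longlongrightarrow> A x / (\<Prod>z\<in>Z - {x}. (x - z) ^ n)) (at x within X)"
      by (rule Lim_transform_eventually)
    then show ?thesis using True by (simp add: h_def)
  next
    case False
    have "((\<lambda>y. f y / (\<Prod>z\<in>Z. (y - z) ^ n)) \<longlongrightarrow> f x / (\<Prod>z\<in>Z. (x - z) ^ n)) (at x within X)"
      using Z False X(2) x by (intro tendsto_intros) (auto simp: continuous_on_def)
    moreover have "\<forall>\<^sub>F y in at x within X. f y / (\<Prod>z\<in>Z. (y - z) ^ n) = h y"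
      using notin by eventually_elim (simp add: h_def)
    ultimately have "(h \<longlongrightarrow> f x / (\<Prod>z\<in>Z. (x - z) ^ n)) (at x within X)"
      by (rule Lim_transform_eventually)
    then show ?thesis using False by (simp add: h_def)
  qed
  then have "continuous_on X h" by (simp add: continuous_on_def)
  moreover have "\<forall>x\<in>X. h x \<noteq> 0" using nz Z by (auto simp: h_def)
  ultimately have "(\<forall>x\<in>X. h x > 0) \<or> (\<forall>x\<in>X. h x < 0)"
    using nonzero_constant_sign X(1) by blast
  then obtain e :: real where e: "\<forall>x\<in>X. e * h x > 0"
    by (metis mult_1 mult_minus1 neg_0_less_iff_less)
  show thesis
  proof (rule that[of e])
    fix x assume x: "x \<in> X - Z"
    then have "e * (f x / (\<Prod>z\<in>Z. (x - z) ^ n)) > 0" using e by (auto simp: h_def)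
    then show "e * f x * (\<Prod>z\<in>Z. (x - z) ^ n) > 0"
      by (auto simp: zero_less_divide_iff zero_less_mult_iff)
  next
    fix x assume x: "x \<in> X \<inter> Z"
    then have "e * (A x / (\<Prod>z\<in>Z-{x}. (x - z) ^ n)) > 0" using e by (auto simp: h_def)
    then show "e * A x * (\<Prod>z\<in>Z-{x}. (x - z) ^ n) > 0"
      by (auto simp: zero_less_divide_iff zero_less_mult_iff)
  qed
qed

text \<open>\<open>Y\<close> collects the zeros at which \<open>q\<close> changes sign. The
  induction adds the largest zero \<open>z\<close>, to the right of which \<open>q\<close> has
  constant sign; \<open>z\<close> enters \<open>Y\<close> exactly when the sign chosen on the left
  is wrong on the right.\<close>

lemma sign_change_set:
  fixes q :: "real \<Rightarrow> real"
  assumes "finite Z" "continuous_on {..<b} q" "\<forall>t\<in>{..<b} - Z. q t \<noteq> 0" "Z \<subseteq> {..<b}" "\<forall>t\<in>Z. q t = 0"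
  shows "\<exists>Y\<subseteq>Z. \<exists>e. e \<noteq> 0 \<and> (\<forall>t<b. e * q t * (\<Prod>y\<in>Y. t - y) \<ge> 0)"
  using assms
proof (induction Z arbitrary: b rule: finite_linorder_max_induct)
  case empty
  then have "(\<forall>x\<in>{..<b}. q x > 0) \<or> (\<forall>x\<in>{..<b}. q x < 0)"
    by (intro nonzero_constant_sign) auto
  then show ?case
  proof
    assume "\<forall>x\<in>{..<b}. q x > 0"
    then show ?thesis by (intro exI[of _ "{}"] conjI exI[of _ 1]) (auto intro: less_imp_le)
  next
    assume "\<forall>x\<in>{..<b}. q x < 0"
    then show ?thesis by (intro exI[of _ "{}"] conjI exI[of _ "-1"]) (auto intro: less_imp_le)
  qed
next
  case (insert z Z)
  have "continuous_on {..<z} q" using insert.prems by (auto intro: continuous_on_subset)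
  then obtain Y e where Y: "Y \<subseteq> Z" "e \<noteq> 0" "\<And>t. t < z \<Longrightarrow> e * q t * (\<Prod>y\<in>Y. t - y) \<ge> 0"
    using insert.IH[of z] insert.prems insert.hyps by force
  have finY: "finite Y" "z \<notin> Y" using Y insert.hyps finite_subset by blast+
  have pos: "(\<Prod>y\<in>Y. t - y) > 0" if "t > z" for t
    using Y(1) insert.hyps(2) that by (intro prod_pos) force
  have "continuous_on {z<..<b} q" using insert.prems by (auto intro: continuous_on_subset)
  then have sgn: "(\<forall>t\<in>{z<..<b}. q t > 0) \<or> (\<forall>t\<in>{z<..<b}. q t < 0)"
    using insert.prems insert.hyps by (intro nonzero_constant_sign) force+
  then have sgn': "(\<forall>t\<in>{z<..<b}. e * q t > 0) \<or> (\<forall>t\<in>{z<..<b}. e * q t < 0)"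
    using Y(2) by (cases "e > 0") (auto simp: mult_neg_neg mult_pos_neg mult_neg_pos not_less)
  show ?case
  proof (cases "\<forall>t\<in>{z<..<b}. e * q t > 0")
    case True
    have "e * q t * (\<Prod>y\<in>Y. t - y) \<ge> 0" if "t < b" for t
    proof (cases t z rule: linorder_cases)
      case less
      then show ?thesis by (rule Y(3))
    next
      case equal
      then show ?thesis using insert.prems by simp
    next
      case greater
      then have "e * q t > 0" using True that by simp
      then show ?thesis using pos[OF greater] by (metis less_imp_le mult_pos_pos)
    qed
    moreover have "Y \<subseteq> insert z Z" using Y(1) by blast
    ultimately show ?thesis using Y(2) by blast
  next
    case False
    \<comment> \<open>Left of \<open>z\<close> the new factor \<open>t - z\<close> is negative and
      cancels the change from \<open>e\<close> to \<open>- e\<close>; right of \<open>z\<close> all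
      factors are positive.\<close>
    have "- e * q t * (\<Prod>y\<in>insert z Y. t - y) \<ge> 0" if "t < b" for t
    proof (cases t z rule: linorder_cases)
      case less
      have "- e * q t * (\<Prod>y\<in>insert z Y. t - y) = (e * q t * (\<Prod>y\<in>Y. t - y)) * (z - t)"
        using finY by (simp add: algebra_simps)
      then show ?thesis using Y(3)[OF less] less by simp
    next
      case equal
      then show ?thesis using insert.prems by simp
    next
      case greater
      have "- e * q t * (\<Prod>y\<in>insert z Y. t - y) = (- (e * q t)) * ((\<Prod>y\<in>Y. t - y) * (t - z))"
        using finY by (simp add: algebra_simps)
      moreover have "- (e * q t) > 0" using False sgn' greater that by auto
      moreover have "(\<Prod>y\<in>Y. t - y) * (t - z) > 0" using pos[OF greater] greater by simp
      ultimately show ?thesis by (metis less_imp_le mult_pos_pos)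
    qed
    moreover have "insert z Y \<subseteq> insert z Z" "- e \<noteq> 0" using Y by auto
    ultimately show ?thesis by blast
  qed
qed

lemma sum_odd_even:
  fixes f :: "nat \<Rightarrow> real"
  shows "(\<Sum>i\<in>{1..M}. f (2 * i - 1) + f (2 * i)) = (\<Sum>j\<in>{1..2 * M}. f j)"
  by (induction M) (simp_all add: add.assoc)

section \<open>Geometry of \<open>L\<^sup>2\<close> and differentiation in norm\<close>

lemma L2_measurable [measurable_dest]: "f \<in> L2 P \<Longrightarrow> f \<in> borel_measurable P"
  by (simp add: L2_def)

lemma L2_integrable_mult:
  assumes "f \<in> L2 P" "g \<in> L2 P"
  shows "integrable P (\<lambda>s. f s * g s)"
proof (rule Bochner_Integration.integrable_bound)
  show "integrable P (\<lambda>s. (f s)\<^sup>2 + (g s)\<^sup>2)" using assms by (simp add: L2_def)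
  show "(\<lambda>s. f s * g s) \<in> borel_measurable P"
    using assms by (intro borel_measurable_times L2_measurable)
  have "\<bar>a * b\<bar> \<le> a\<^sup>2 + b\<^sup>2" for a b :: real
  proof -
    have "0 \<le> \<bar>a\<bar> * \<bar>b\<bar>" by simp
    then show ?thesis using sum_squares_bound[of "\<bar>a\<bar>" "\<bar>b\<bar>"]
      unfolding abs_mult power2_abs by linarith
  qed
  then show "AE s in P. norm (f s * g s) \<le> norm ((f s)\<^sup>2 + (g s)\<^sup>2)" by simp
qed

lemma L2_cmult: "f \<in> L2 P \<Longrightarrow> (\<lambda>s. a * f s) \<in> L2 P"
  by (simp add: L2_def power_mult_distrib borel_measurable_times)

lemma L2_add:
  assumes "f \<in> L2 P" "g \<in> L2 P"
  shows "(\<lambda>s. f s + g s) \<in> L2 P"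
  using assms L2_integrable_mult[OF assms] by (simp add: L2_def power2_sum mult.assoc borel_measurable_add)

lemma L2_diff:
  assumes "f \<in> L2 P" "g \<in> L2 P"
  shows "(\<lambda>s. f s - g s) \<in> L2 P"
  using L2_add[OF assms(1) L2_cmult[OF assms(2), of "-1"]] by simp

lemma L2_zero: "(\<lambda>s. 0) \<in> L2 P" by (simp add: L2_def)

lemma L2_sum:
  assumes "\<And>i. i \<in> I \<Longrightarrow> f i \<in> L2 P"
  shows "(\<lambda>s. \<Sum>i\<in>I. b i * f i s) \<in> L2 P"
  using assms
  by (induction I rule: infinite_finite_induct) (auto intro!: L2_add L2_cmult L2_zero)

lemma L2_inner_commute: "L2_inner P f g = L2_inner P g f"
  by (simp add: L2_inner_def mult.commute)

lemma L2_inner_diff_left: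
  assumes "f \<in> L2 P" "g \<in> L2 P" "h \<in> L2 P"
  shows "L2_inner P (\<lambda>s. f s - g s) h = L2_inner P f h - L2_inner P g h"
  using L2_integrable_mult[OF assms(1,3)] L2_integrable_mult[OF assms(2,3)]
  by (simp add: L2_inner_def left_diff_distrib)

lemma L2_inner_sum_left:
  assumes "\<And>i. i \<in> I \<Longrightarrow> f i \<in> L2 P" "h \<in> L2 P"
  shows "L2_inner P (\<lambda>s. \<Sum>i\<in>I. b i * f i s) h = (\<Sum>i\<in>I. b i * L2_inner P (f i) h)"
proof -
  have "integrable P (\<lambda>s. b i * (f i s * h s))" if "i \<in> I" for i
    using L2_integrable_mult[OF assms(1)[OF that] assms(2)] by simp
  then show ?thesis
    by (simp add: L2_inner_def sum_distrib_right mult.assoc Bochner_Integration.integral_sum)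
qed

lemma L2_inner_cong_AE:
  assumes "f \<in> L2 P" "f' \<in> L2 P" "g \<in> L2 P" "g' \<in> L2 P"
    and "AE s in P. f s = f' s" "AE s in P. g s = g' s"
  shows "L2_inner P f g = L2_inner P f' g'"
  unfolding L2_inner_def
  by (rule integral_cong_AE) (use assms in \<open>auto simp: L2_def\<close>)

lemma L2_inner_self_nonneg: "L2_inner P f f \<ge> 0"
  by (simp add: L2_inner_def)

lemma L2_norm_cong_AE:
  assumes "f \<in> L2 P" "f' \<in> L2 P" "AE s in P. f s = f' s"
  shows "L2_norm P f = L2_norm P f'"
  unfolding L2_norm_def using L2_inner_cong_AE[OF assms(1,2,1,2,3,3)] by simp

lemma L2_norm_eq_0:
  assumes "f \<in> L2 P" "L2_norm P f = 0"
  shows "AE s in P. f s = 0"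
proof -
  have "(LINT s|P. f s * f s) = 0" using assms(2) by (simp add: L2_norm_def L2_inner_def)
  then have "AE s in P. f s * f s = 0"
    using integral_nonneg_eq_0_iff_AE[OF L2_integrable_mult[OF assms(1,1)]] by simp
  then show ?thesis by eventually_elim simp
qed

lemma L2_Cauchy_Schwarz:
  assumes f: "f \<in> L2 P" and g: "g \<in> L2 P"
  shows "\<bar>L2_inner P f g\<bar> \<le> L2_norm P f * L2_norm P g"
proof -
  define A B C where "A = L2_inner P f f" and "B = L2_inner P g g" and "C = L2_inner P f g"
  have C2: "C\<^sup>2 \<le> A * B"
  proof (cases "B = 0")
    case True
    then have "AE s in P. g s = 0" using L2_norm_eq_0[OF g] by (simp add: B_def L2_norm_def)
    then have "C = L2_inner P f (\<lambda>s. 0)" unfolding C_def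
      by (intro L2_inner_cong_AE f g L2_zero) auto
    then show ?thesis using True by (simp add: L2_inner_def)
  next
    case False
    then have "B > 0" using L2_inner_self_nonneg[of P g] by (simp add: B_def)
    \<comment> \<open>The expansion of this square is \<open>B * (A * B - C\<^sup>2)\<close>, from
      which the positive factor \<open>B\<close> can be cancelled.\<close>
    have "0 \<le> L2_inner P (\<lambda>s. B * f s - C * g s) (\<lambda>s. B * f s - C * g s)"
      by (rule L2_inner_self_nonneg)
    also have "\<dots> = (LINT s|P. B * B * (f s * f s) - 2 * B * C * (f s * g s) + C * C * (g s * g s))"
      unfolding L2_inner_def by (rule Bochner_Integration.integral_cong) (auto simp: algebra_simps)
    also have "\<dots> = B * B * A - 2 * B * C * C + C * C * B"
      using L2_integrable_mult[OF f f] L2_integrable_mult[OF f g] L2_integrable_mult[OF g g]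
      by (simp add: A_def B_def C_def L2_inner_def)
    also have "\<dots> = B * (A * B - C\<^sup>2)" by (simp add: algebra_simps power2_eq_square)
    finally show ?thesis using \<open>B > 0\<close> by (simp add: zero_le_mult_iff)
  qed
  have "\<bar>C\<bar> \<le> sqrt (A * B)" using real_sqrt_le_mono[OF C2] by simp
  then show ?thesis by (simp add: A_def B_def C_def L2_norm_def real_sqrt_mult)
qed

text \<open>Pairing with \<open>p\<close> is continuous by Cauchy-Schwarz, so convergence of
  difference quotients in norm passes to the real-valued function.\<close>

lemma has_L2_deriv_inner:
  assumes \<phi>: "has_L2_deriv P X \<phi> D x" and p: "p \<in> L2 P" and x: "x \<in> X"
  shows "((\<lambda>y. L2_inner P (\<phi> y) p) has_real_derivative L2_inner P D p) (at x within X)"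
proof -
  have L: "\<And>y. y \<in> X \<Longrightarrow> \<phi> y \<in> L2 P" "D \<in> L2 P"
    using \<phi> by (auto simp: has_L2_deriv_def)
  define d where "d y s = (\<phi> y s - \<phi> x s) / (y - x) - D s" for y s
  have dd: "(\<lambda>s. (\<phi> y s - \<phi> x s) / (y - x)) \<in> L2 P" if "y \<in> X" for y
    using L2_cmult[OF L2_diff[OF L(1)[OF that] L(1)[OF x]], of "inverse (y - x)"]
    by (simp add: field_simps)
  have "d y \<in> L2 P" if "y \<in> X" for y
    using L2_diff[OF dd[OF that] L(2)] by (simp add: d_def[abs_def])
  note dL = this
  have eq: "(L2_inner P (\<phi> y) p - L2_inner P (\<phi> x) p) / (y - x) - L2_inner P D p = L2_inner P (d y) p"
    if "y \<in> X" for y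
  proof -
    have "L2_inner P (d y) p = L2_inner P (\<lambda>s. (\<phi> y s - \<phi> x s) / (y - x)) p - L2_inner P D p"
      unfolding d_def[abs_def] by (rule L2_inner_diff_left[OF dd[OF that] L(2) p])
    also have "L2_inner P (\<lambda>s. (\<phi> y s - \<phi> x s) / (y - x)) p = L2_inner P (\<lambda>s. \<phi> y s - \<phi> x s) p / (y - x)"
      by (simp add: L2_inner_def)
    finally show ?thesis
      by (simp add: L2_inner_diff_left[OF L(1)[OF that] L(1)[OF x] p])
  qed
  have "((\<lambda>y. L2_norm P (d y) * L2_norm P p) \<longlongrightarrow> 0) (at x within X)"
    using \<phi> unfolding has_L2_deriv_def d_def[abs_def] by (auto intro!: tendsto_mult_left_zero)
  moreover have "\<forall>\<^sub>F y in at x within X. norm (L2_inner P (d y) p) \<le> L2_norm P (d y) * L2_norm P p"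
    using L2_Cauchy_Schwarz[OF dL p] by (auto simp: eventually_at_filter)
  ultimately have "((\<lambda>y. L2_inner P (d y) p) \<longlongrightarrow> 0) (at x within X)"
    by (rule Lim_null_comparison[rotated])
  then have "((\<lambda>y. (L2_inner P (\<phi> y) p - L2_inner P (\<phi> x) p) / (y - x) - L2_inner P D p) \<longlongrightarrow> 0) (at x within X)"
    by (rule Lim_transform_eventually) (use eq in \<open>auto simp: eventually_at_filter\<close>)
  then show ?thesis
    unfolding has_field_derivative_iff by (simp add: LIM_zero_iff)
qed

lemma L2_continuous_on_inner:
  assumes \<phi>: "L2_continuous_on P X \<phi>" and p: "p \<in> L2 P"
  shows "continuous_on X (\<lambda>x. L2_inner P (\<phi> x) p)"
  unfolding continuous_on_def
proof
  fix x assume x: "x \<in> X"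
  have L: "\<And>y. y \<in> X \<Longrightarrow> \<phi> y \<in> L2 P" using \<phi> by (auto simp: L2_continuous_on_def)
  have "((\<lambda>y. L2_norm P (\<lambda>s. \<phi> y s - \<phi> x s) * L2_norm P p) \<longlongrightarrow> 0) (at x within X)"
    using \<phi> x by (auto simp: L2_continuous_on_def intro!: tendsto_mult_left_zero)
  moreover have "\<forall>\<^sub>F y in at x within X. norm (L2_inner P (\<phi> y) p - L2_inner P (\<phi> x) p)
      \<le> L2_norm P (\<lambda>s. \<phi> y s - \<phi> x s) * L2_norm P p"
    using L2_Cauchy_Schwarz[OF L2_diff[OF L L[OF x]] p] L2_inner_diff_left[OF L L[OF x] p]
    by (auto simp: eventually_at_filter)
  ultimately have "((\<lambda>y. L2_inner P (\<phi> y) p - L2_inner P (\<phi> x) p) \<longlongrightarrow> 0) (at x within X)"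
    by (rule Lim_null_comparison[rotated])
  then show "((\<lambda>y. L2_inner P (\<phi> y) p) \<longlongrightarrow> L2_inner P (\<phi> x) p) (at x within X)"
    by (simp add: LIM_zero_iff)
qed

section \<open>Derivatives in norm up to almost everywhere equality\<close>

lemma has_L2_deriv_L2_deriv:
  "has_L2_deriv P X \<phi> D x \<Longrightarrow> has_L2_deriv P X \<phi> (L2_deriv P X \<phi> x) x"
  unfolding L2_deriv_def by (rule someI[of "\<lambda>D. has_L2_deriv P X \<phi> D x"])

text \<open>Both candidates are tested against their own difference \<open>p\<close>. Uniqueness of
  the real derivative makes the inner product of \<open>p\<close> with itself zero.\<close>

lemma has_L2_deriv_unique:
  assumes D: "has_L2_deriv P X \<phi> D x" and D': "has_L2_deriv P X \<phi> D' x"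
    and x: "x \<in> X" "at x within X \<noteq> bot"
  shows "AE s in P. D s = D' s"
proof -
  have L: "D \<in> L2 P" "D' \<in> L2 P" using D D' by (auto simp: has_L2_deriv_def)
  define p where "p s = D s - D' s" for s
  have p: "p \<in> L2 P" unfolding p_def[abs_def] by (rule L2_diff[OF L])
  have "L2_inner P D p = L2_inner P D' p"
    using has_L2_deriv_inner[OF D p x(1)] has_L2_deriv_inner[OF D' p x(1)] x(2)
    unfolding has_field_derivative_iff by (rule tendsto_unique[rotated])
  then have "L2_inner P p p = 0"
    using L2_inner_diff_left[OF L p] by (simp add: p_def[abs_def])
  then have "AE s in P. p s = 0" by (intro L2_norm_eq_0[OF p]) (simp add: L2_norm_def)
  then show ?thesis by eventually_elim (simp add: p_def)
qed

text \<open>\<open>L2_deriv\<close> chooses some representative, so iterated derivatives are known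
  only almost everywhere; this lemma makes it possible to differentiate them again.\<close>

lemma has_L2_deriv_cong_AE:
  assumes D: "has_L2_deriv P X \<phi> D x" and x: "x \<in> X" and D': "D' \<in> L2 P" "AE s in P. D s = D' s"
    and \<phi>': "\<And>y. y \<in> X \<Longrightarrow> \<phi>' y \<in> L2 P" "\<And>y. y \<in> X \<Longrightarrow> AE s in P. \<phi> y s = \<phi>' y s"
  shows "has_L2_deriv P X \<phi>' D' x"
proof -
  have L: "\<And>y. y \<in> X \<Longrightarrow> \<phi> y \<in> L2 P" "D \<in> L2 P" using D by (auto simp: has_L2_deriv_def)
  have eq: "L2_norm P (\<lambda>s. (\<phi> y s - \<phi> x s) / (y - x) - D s) = L2_norm P (\<lambda>s. (\<phi>' y s - \<phi>' x s) / (y - x) - D' s)"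
    if y: "y \<in> X" for y
  proof (rule L2_norm_cong_AE)
    have dd: "(\<lambda>s. (f y s - f x s) / (y - x) - E s) \<in> L2 P"
      if "\<And>y. y \<in> X \<Longrightarrow> f y \<in> L2 P" "E \<in> L2 P" for f E
      using L2_diff[OF L2_cmult[OF L2_diff[OF that(1)[OF y] that(1)[OF x]], of "inverse (y - x)"] that(2)]
      by (simp add: field_simps)
    show "(\<lambda>s. (\<phi> y s - \<phi> x s) / (y - x) - D s) \<in> L2 P" by (rule dd[OF L])
    show "(\<lambda>s. (\<phi>' y s - \<phi>' x s) / (y - x) - D' s) \<in> L2 P" by (rule dd[OF \<phi>'(1) D'(1)])
    show "AE s in P. (\<phi> y s - \<phi> x s) / (y - x) - D s = (\<phi>' y s - \<phi>' x s) / (y - x) - D' s"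
      using \<phi>'(2)[OF y] \<phi>'(2)[OF x] D'(2) by eventually_elim simp
  qed
  have "((\<lambda>y. L2_norm P (\<lambda>s. (\<phi> y s - \<phi> x s) / (y - x) - D s)) \<longlongrightarrow> 0) (at x within X)"
    using D by (simp add: has_L2_deriv_def)
  then have "((\<lambda>y. L2_norm P (\<lambda>s. (\<phi>' y s - \<phi>' x s) / (y - x) - D' s)) \<longlongrightarrow> 0) (at x within X)"
    by (rule Lim_transform_eventually) (use eq in \<open>auto simp: eventually_at_filter\<close>)
  then show ?thesis using D'(1) \<phi>'(1) by (simp add: has_L2_deriv_def)
qed

section \<open>The Laplace kernel\<close>

lemma at_within_atLeast_nontrivial: "c \<le> x \<Longrightarrow> at x within {c..} \<noteq> bot" for c x :: real
proof
  assume "c \<le> x" "at x within {c..} = bot"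
  moreover from this have "{x<..} \<subseteq> {c..}" by auto
  ultimately have "at_right x \<le> bot" using at_le[of "{x<..}" "{c..}" x] by metis
  then show False using trivial_limit_at_right_real[of x] by (simp add: bot_unique)
qed

text \<open>This is (-s)^k exp(-x s) for the index \<open>(x, k)\<close>, the derivative of order k
  in x of the Laplace kernel. Writing it through \<open>monom_exp\<close> at \<open>- s\<close>
  makes the zero count applicable.\<close>

definition lap :: "real \<times> nat \<Rightarrow> real \<Rightarrow> real" where
  "lap i s = monom_exp i (- s)"

text \<open>\<open>N\<close> is the highest order of differentiation, later \<open>2 * M\<close>.
  The moment condition makes every \<open>lap (x, k)\<close> with \<open>c \<le> x\<close> and
  \<open>k \<le> N\<close> square integrable.\<close>

locale laplace_kernel =
  fixes P :: "real measure" and c :: real and N :: nat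
  assumes space_pos: "space P \<subseteq> {0<..}"
    and sets_P: "sets P = sets (restrict_space borel (space P))"
    and moment: "integrable P (\<lambda>s. (1 + s) ^ (2 * N) * exp (- 2 * c * s))"
begin

lemma AE_pos: "AE s in P. s > 0"
  using space_pos by auto

lemma lap_measurable: "lap i \<in> borel_measurable P"
proof -
  have "continuous_on UNIV (lap i)"
    unfolding lap_def[abs_def] monom_exp_def by (intro continuous_intros)
  then have "lap i \<in> borel_measurable (restrict_space borel (space P))"
    by (intro measurable_restrict_space1 borel_measurable_continuous_onI)
  then show ?thesis using measurable_cong_sets[OF sets_P refl] by blast
qed

lemma lap_sq_le:
  assumes "c \<le> fst i" "snd i \<le> N" "s > 0"
  shows "(lap i s)\<^sup>2 \<le> (1 + s) ^ (2 * N) * exp (- 2 * c * s)"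
proof -
  have "(lap i s)\<^sup>2 = s ^ (2 * snd i) * exp (- 2 * fst i * s)"
    by (simp add: lap_def monom_exp_def power_mult_distrib power_minus_even power_even_eq[symmetric]
        exp_double[symmetric] flip: power_mult)
       (simp add: power_mult power2_eq_square mult_ac flip: exp_add)
  also have "s ^ (2 * snd i) \<le> (1 + s) ^ (2 * snd i)" using assms by (intro power_mono) auto
  also have "(1 + s) ^ (2 * snd i) \<le> (1 + s) ^ (2 * N)" using assms by (intro power_increasing) auto
  also have "exp (- 2 * fst i * s) \<le> exp (- 2 * c * s)" using assms by simp
  finally show ?thesis using assms by (simp add: mult_mono)
qed

lemma lap_L2:
  assumes "c \<le> fst i" "snd i \<le> N"
  shows "lap i \<in> L2 P"
proof -
  have "integrable P (\<lambda>s. (lap i s)\<^sup>2)"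
  proof (rule Bochner_Integration.integrable_bound[OF moment])
    show "(\<lambda>s. (lap i s)\<^sup>2) \<in> borel_measurable P" by (intro borel_measurable_power lap_measurable)
    show "AE s in P. norm ((lap i s)\<^sup>2) \<le> norm ((1 + s) ^ (2 * N) * exp (- 2 * c * s))"
      using AE_pos
    proof eventually_elim
      case (elim s)
      then show ?case using lap_sq_le[OF assms, of s] by simp
    qed
  qed
  then show ?thesis using lap_measurable by (simp add: L2_def)
qed

lemma lap_has_derivative:
  "((\<lambda>x. lap (x, k) s) has_real_derivative lap (x, Suc k) s) (at x within A)"
  unfolding lap_def monom_exp_def
  by (auto intro!: derivative_eq_intros)

text \<open>By the mean value theorem the quotient equals \<open>lap (z, Suc k) s\<close> for some
  \<open>z\<close> between \<open>x\<close> and \<open>y\<close>, and on s > 0 the absolute value is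
  largest at \<open>c\<close>. The bound does not depend on \<open>y\<close> and so can serve as a
  dominating function.\<close>

lemma lap_quotient_bound:
  assumes "c \<le> x" "c \<le> y" "y \<noteq> x" "s > 0"
  shows "\<bar>(lap (y, k) s - lap (x, k) s) / (y - x) - lap (x, Suc k) s\<bar> \<le> 2 * \<bar>lap (c, Suc k) s\<bar>"
proof -
  have le: "\<bar>lap (z, Suc k) s\<bar> \<le> \<bar>lap (c, Suc k) s\<bar>" if "c \<le> z" for z
    using that assms by (simp add: lap_def monom_exp_def abs_mult mult_left_mono)
  have "\<exists>z\<ge>c. (lap (y, k) s - lap (x, k) s) / (y - x) = lap (z, Suc k) s"
  proof -
    note D = lap_has_derivative[of k s _ UNIV]
    consider "x < y" | "y < x" using assms by linarith
    then show ?thesis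
    proof cases
      case 1
      from MVT2[OF this D] obtain z where "x < z" "lap (y, k) s - lap (x, k) s = (y - x) * lap (z, Suc k) s"
        by blast
      then show ?thesis using assms 1 by (intro exI[of _ z]) (simp add: field_simps)
    next
      case 2
      from MVT2[OF this D] obtain z where "y < z" "lap (x, k) s - lap (y, k) s = (x - y) * lap (z, Suc k) s"
        by blast
      then show ?thesis using assms 2 by (intro exI[of _ z]) (simp add: field_simps)
    qed
  qed
  then obtain z where z: "c \<le> z" "(lap (y, k) s - lap (x, k) s) / (y - x) = lap (z, Suc k) s"
    by blast
  show ?thesis unfolding z(2) using le[OF z(1)] le[OF assms(1)] by linarith
qed

text \<open>Dominated convergence for the squares, along sequences tending to
  \<open>x\<close>.\<close>

lemma L2_tendsto_0:
  fixes f :: "real \<Rightarrow> real \<Rightarrow> real"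
  assumes meas: "\<And>y. f y \<in> borel_measurable P"
    and bound: "\<And>y s. y \<in> X - {x} \<Longrightarrow> s > 0 \<Longrightarrow> \<bar>f y s\<bar> \<le> 2 * \<bar>lap (c, k) s\<bar>" and k: "k \<le> N"
    and lim: "\<And>s. s > 0 \<Longrightarrow> ((\<lambda>y. f y s) \<longlongrightarrow> 0) (at x within X)"
  shows "((\<lambda>y. L2_norm P (f y)) \<longlongrightarrow> 0) (at x within X)"
  unfolding tendsto_at_iff_sequentially comp_def
proof (intro allI impI)
  fix Y assume Y: "\<forall>i. Y i \<in> X - {x}" "Y \<longlonglongrightarrow> x"
  have "(\<lambda>n. LINT s|P. f (Y n) s * f (Y n) s) \<longlonglongrightarrow> (LINT s|P. 0)"
  proof (rule integral_dominated_convergence[where w="\<lambda>s. 4 * (lap (c, k) s)\<^sup>2"])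
    show "integrable P (\<lambda>s. 4 * (lap (c, k) s)\<^sup>2)"
      using lap_L2[of "(c, k)"] k by (simp add: L2_def)
    show "AE s in P. (\<lambda>n. f (Y n) s * f (Y n) s) \<longlonglongrightarrow> 0"
      using AE_pos
    proof eventually_elim
      case (elim s)
      from lim[OF this] Y have "(\<lambda>n. f (Y n) s) \<longlonglongrightarrow> 0"
        unfolding tendsto_at_iff_sequentially comp_def by blast
      from tendsto_mult[OF this this] show ?case by simp
    qed
    show "AE s in P. norm (f (Y n) s * f (Y n) s) \<le> 4 * (lap (c, k) s)\<^sup>2" for n
      using AE_pos
    proof eventually_elim
      case (elim s)
      have "\<bar>f (Y n) s\<bar>\<^sup>2 \<le> (2 * \<bar>lap (c, k) s\<bar>)\<^sup>2"
        using bound[of "Y n" s] Y elim by (intro power_mono) auto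
      then show ?case by (simp add: power_mult_distrib power2_eq_square)
    qed
  qed (use meas in \<open>auto intro: borel_measurable_times\<close>)
  then have "(\<lambda>n. L2_inner P (f (Y n)) (f (Y n))) \<longlonglongrightarrow> 0" by (simp add: L2_inner_def)
  from tendsto_real_sqrt[OF this] show "(\<lambda>n. L2_norm P (f (Y n))) \<longlonglongrightarrow> 0"
    by (simp add: L2_norm_def)
qed

lemma lap_has_L2_deriv:
  assumes "k < N" "c \<le> x"
  shows "has_L2_deriv P {c..} (\<lambda>x. lap (x, k)) (lap (x, Suc k)) x"
  unfolding has_L2_deriv_def
proof (intro conjI ballI)
  show "((\<lambda>y. L2_norm P (\<lambda>s. (lap (y, k) s - lap (x, k) s) / (y - x) - lap (x, Suc k) s)) \<longlongrightarrow> 0)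
     (at x within {c..})"
  proof (rule L2_tendsto_0[where k="Suc k"])
    show "(\<lambda>s. (lap (y, k) s - lap (x, k) s) / (y - x) - lap (x, Suc k) s) \<in> borel_measurable P" for y
      by (intro borel_measurable_diff borel_measurable_divide lap_measurable borel_measurable_const)
    show "((\<lambda>y. (lap (y, k) s - lap (x, k) s) / (y - x) - lap (x, Suc k) s) \<longlongrightarrow> 0) (at x within {c..})" for s
      using lap_has_derivative[of k s x "{c..}"] unfolding has_field_derivative_iff by (simp add: LIM_zero_iff)
  qed (use assms in \<open>auto intro!: lap_quotient_bound\<close>)
qed (use assms in \<open>auto intro!: lap_L2\<close>)

lemma lap_L2_continuous:
  assumes "k \<le> N"
  shows "L2_continuous_on P {c..} (\<lambda>x. lap (x, k))"
  unfolding L2_continuous_on_def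
proof (intro conjI ballI)
  fix x assume x: "x \<in> {c..}"
  show "((\<lambda>y. L2_norm P (\<lambda>s. lap (y, k) s - lap (x, k) s)) \<longlongrightarrow> 0) (at x within {c..})"
  proof (rule L2_tendsto_0[where k=k])
    show "(\<lambda>s. lap (y, k) s - lap (x, k) s) \<in> borel_measurable P" for y
      by (intro borel_measurable_diff lap_measurable)
    show "((\<lambda>y. lap (y, k) s - lap (x, k) s) \<longlongrightarrow> 0) (at x within {c..})" for s
      using DERIV_continuous[OF lap_has_derivative[of k s x "{c..}"]]
      unfolding continuous_within by (simp add: LIM_zero_iff)
    have le: "\<bar>lap (z, k) s\<bar> \<le> \<bar>lap (c, k) s\<bar>" if "c \<le> z" "s > 0" for z s
      using that by (simp add: lap_def monom_exp_def abs_mult mult_left_mono)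
    show "\<bar>lap (y, k) s - lap (x, k) s\<bar> \<le> 2 * \<bar>lap (c, k) s\<bar>" if "y \<in> {c..} - {x}" "s > 0" for y s
      using le[of x s] le[of y s] that x by simp
  qed (use assms in simp)
qed (use assms in \<open>auto intro!: lap_L2\<close>)

text \<open>At each order the chosen derivative is compared with \<open>lap (x, Suc k)\<close> by
  uniqueness. Membership in \<open>L2\<close> is carried along because replacing one representative
  by another requires it.\<close>

lemma L2_derivs_lap:
  assumes "k \<le> N" "c \<le> x"
  shows "L2_derivs P {c..} k (\<lambda>x. lap (x, 0)) x \<in> L2 P \<and>
    (AE s in P. lap (x, k) s = L2_derivs P {c..} k (\<lambda>x. lap (x, 0)) x s)"
  using assms
proof (induction k arbitrary: x)
  case 0
  then show ?case using lap_L2[of "(x, 0)"] by simp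
next
  case (Suc k)
  let ?\<phi> = "L2_derivs P {c..} k (\<lambda>x. lap (x, 0))"
  have d: "has_L2_deriv P {c..} ?\<phi> (lap (x, Suc k)) x"
    using Suc by (intro has_L2_deriv_cong_AE[OF lap_has_L2_deriv]) (auto intro: lap_L2)
  then have d': "has_L2_deriv P {c..} ?\<phi> (L2_deriv P {c..} ?\<phi> x) x"
    by (rule has_L2_deriv_L2_deriv)
  have "AE s in P. lap (x, Suc k) s = L2_deriv P {c..} ?\<phi> x s"
    using Suc.prems by (intro has_L2_deriv_unique[OF d d'] at_within_atLeast_nontrivial) auto
  moreover have "L2_deriv P {c..} ?\<phi> x \<in> L2 P" using d' by (simp add: has_L2_deriv_def)
  ultimately show ?case by simp
qed

lemma L2_derivs_lap_has_deriv:
  assumes "k < N" "c \<le> x"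
  shows "has_L2_deriv P {c..} (L2_derivs P {c..} k (\<lambda>x. lap (x, 0))) (lap (x, Suc k)) x"
  using assms L2_derivs_lap[of k]
  by (intro has_L2_deriv_cong_AE[OF lap_has_L2_deriv]) (auto intro: lap_L2)

lemma inner_lap_has_derivative:
  assumes "k < N" "c \<le> x" "p \<in> L2 P"
  shows "((\<lambda>x. L2_inner P (lap (x, k)) p) has_real_derivative L2_inner P (lap (x, Suc k)) p)
    (at x within {c..})"
  using has_L2_deriv_inner[OF lap_has_L2_deriv[OF assms(1,2)] assms(3)] assms(2) by simp

lemma derivs_within_inner_lap:
  assumes "k \<le> N" "c \<le> x" "p \<in> L2 P"
  shows "derivs_within {c..} k (\<lambda>x. L2_inner P (lap (x, 0)) p) x = L2_inner P (lap (x, k)) p"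
  using assms
proof (induction k arbitrary: x)
  case (Suc k)
  let ?f = "derivs_within {c..} k (\<lambda>x. L2_inner P (lap (x, 0)) p)"
  have "((\<lambda>x. L2_inner P (lap (x, k)) p) has_vector_derivative L2_inner P (lap (x, Suc k)) p)
    (at x within {c..})"
    using inner_lap_has_derivative[of k x p] Suc.prems
    by (simp add: has_real_derivative_iff_has_vector_derivative)
  then have "(?f has_vector_derivative L2_inner P (lap (x, Suc k)) p) (at x within {c..})"
    by (rule has_vector_derivative_transform[rotated 2]) (use Suc in auto)
  then have "vector_derivative ?f (at x within {c..}) = L2_inner P (lap (x, Suc k)) p"
    using Suc.prems by (intro vector_derivative_within at_within_atLeast_nontrivial)
  then show ?case by simp
qed simp

lemma inner_lap_tendsto_0:
  assumes "p \<in> L2 P"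
  shows "((\<lambda>x. L2_inner P (lap (x, 0)) p) \<longlongrightarrow> 0) at_top"
proof -
  \<comment> \<open>The cutoff below \<open>c\<close> makes one dominating function valid for every
    x and does not affect the limit at infinity.\<close>
  have "((\<lambda>x. LINT s|P. (if c \<le> x then lap (x, 0) s else 0) * p s) \<longlongrightarrow> (LINT s|P. 0)) at_top"
  proof (rule integral_dominated_convergence_at_top[where w="\<lambda>s. \<bar>lap (c, 0) s * p s\<bar>"])
    show "integrable P (\<lambda>s. \<bar>lap (c, 0) s * p s\<bar>)"
      using L2_integrable_mult[OF lap_L2[of "(c, 0)"] assms] by simp
    show "AE s in P. ((\<lambda>x. (if c \<le> x then lap (x, 0) s else 0) * p s) \<longlongrightarrow> 0) at_top"
      using AE_pos
    proof eventually_elim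
      case (elim s)
      have "((\<lambda>x. exp (- (x * s))) \<longlongrightarrow> 0) at_top"
        using elim by real_asymp
      then have "((\<lambda>x. lap (x, 0) s * p s) \<longlongrightarrow> 0) at_top"
        unfolding lap_def monom_exp_def by (intro tendsto_mult_left_zero) simp
      then show ?case
        by (rule Lim_transform_eventually) (auto intro: eventually_mono[OF eventually_ge_at_top[of c]])
    qed
    show "\<forall>\<^sub>F x in at_top. AE s in P. norm ((if c \<le> x then lap (x, 0) s else 0) * p s) \<le> \<bar>lap (c, 0) s * p s\<bar>"
    proof (rule always_eventually, rule allI)
      fix x
      show "AE s in P. norm ((if c \<le> x then lap (x, 0) s else 0) * p s) \<le> \<bar>lap (c, 0) s * p s\<bar>"
        using AE_pos
        by eventually_elim (auto simp: lap_def monom_exp_def abs_mult mult_right_mono)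
    qed
    show "(\<lambda>s. (if c \<le> x then lap (x, 0) s else 0) * p s) \<in> borel_measurable P" for x
      using assms lap_measurable by (auto intro!: borel_measurable_times L2_measurable)
  qed simp
  then have "((\<lambda>x. LINT s|P. (if c \<le> x then lap (x, 0) s else 0) * p s) \<longlongrightarrow> 0) at_top" by simp
  then show ?thesis
    by (rule Lim_transform_eventually)
       (auto intro: eventually_mono[OF eventually_ge_at_top[of c]] simp: L2_inner_def)
qed

text \<open>Continuity of the top derivative is transferred from \<open>lap (x, N)\<close>. The
  \<open>C0\<close> condition combines continuity with decay at infinity, where the compact set is
  an interval \<open>{c..R}\<close>. The norms are bounded by their values at
  \<open>c\<close>.\<close>

lemma lap_admissible: "(\<lambda>x. lap (x, 0)) \<in> admissible P {c..} N"
  unfolding admissible_def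
proof (safe)
  let ?\<phi> = "\<lambda>x. lap (x, 0)"
  have "L2_continuous_on P {c..} (L2_derivs P {c..} N ?\<phi>)"
    unfolding L2_continuous_on_def
  proof (intro conjI ballI)
    fix x assume x: "x \<in> {c..}"
    have lim: "((\<lambda>y. L2_norm P (\<lambda>s. lap (y, N) s - lap (x, N) s)) \<longlongrightarrow> 0) (at x within {c..})"
      using lap_L2_continuous[of N] x by (auto simp: L2_continuous_on_def)
    have eq: "L2_norm P (\<lambda>s. lap (y, N) s - lap (x, N) s) =
      L2_norm P (\<lambda>s. L2_derivs P {c..} N ?\<phi> y s - L2_derivs P {c..} N ?\<phi> x s)" if "y \<in> {c..}" for y
    proof (rule L2_norm_cong_AE)
      show "AE s in P. lap (y, N) s - lap (x, N) s = L2_derivs P {c..} N ?\<phi> y s - L2_derivs P {c..} N ?\<phi> x s"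
        using L2_derivs_lap[of N x, THEN conjunct2] L2_derivs_lap[of N y, THEN conjunct2] x that by auto
    qed (use x that in \<open>auto intro!: L2_diff lap_L2 simp: L2_derivs_lap\<close>)
    from lim show "((\<lambda>y. L2_norm P (\<lambda>s. L2_derivs P {c..} N ?\<phi> y s - L2_derivs P {c..} N ?\<phi> x s)) \<longlongrightarrow> 0)
        (at x within {c..})"
      by (rule Lim_transform_eventually) (use eq in \<open>auto simp: eventually_at_filter\<close>)
  qed (use L2_derivs_lap in auto)
  then show "?\<phi> \<in> L2_Ck P {c..} N"
    unfolding L2_Ck_def using L2_derivs_lap_has_deriv by blast
next
  fix p assume p: "p \<in> L2 P"
  let ?f = "\<lambda>x. L2_inner P (lap (x, 0)) p"
  have "continuous_on {c..} ?f"
    by (rule L2_continuous_on_inner[OF lap_L2_continuous p]) simp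
  moreover have "\<exists>K\<subseteq>{c..}. compact K \<and> (\<forall>x\<in>{c..} - K. \<bar>?f x\<bar> \<le> \<epsilon>)" if e: "\<epsilon> > 0" for \<epsilon>
  proof -
    obtain R where R: "\<And>x. x \<ge> R \<Longrightarrow> \<bar>?f x\<bar> < \<epsilon>"
      using tendstoD[OF inner_lap_tendsto_0[OF p] e] by (auto simp: eventually_at_top_linorder)
    then show ?thesis by (intro exI[of _ "{c..R}"]) (auto intro: less_imp_le)
  qed
  ultimately show "(\<lambda>x. L2_inner P p (lap (x, 0))) \<in> C0 {c..}"
    by (simp add: C0_def L2_inner_commute[of P p])
next
  fix i assume i: "i \<le> N"
  have "L2_norm P (L2_derivs P {c..} i (\<lambda>x. lap (x, 0)) x) \<le> L2_norm P (lap (c, i))" if x: "c \<le> x" for x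
  proof -
    have "L2_norm P (L2_derivs P {c..} i (\<lambda>x. lap (x, 0)) x) = L2_norm P (lap (x, i))"
      using L2_derivs_lap[OF i x] lap_L2[of "(x, i)"] i x by (intro L2_norm_cong_AE) auto
    also have "\<dots> \<le> L2_norm P (lap (c, i))"
      unfolding L2_norm_def L2_inner_def
    proof (intro real_sqrt_le_mono integral_mono_AE)
      show "integrable P (\<lambda>s. lap (x, i) s * lap (x, i) s)" "integrable P (\<lambda>s. lap (c, i) s * lap (c, i) s)"
        using i x by (auto intro!: L2_integrable_mult lap_L2)
      show "AE s in P. lap (x, i) s * lap (x, i) s \<le> lap (c, i) s * lap (c, i) s"
        using AE_pos
      proof eventually_elim
        case (elim s)
        have "\<bar>lap (x, i) s\<bar> \<le> \<bar>lap (c, i) s\<bar>"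
          using elim x by (simp add: lap_def monom_exp_def abs_mult mult_left_mono)
        then have "(lap (x, i) s)\<^sup>2 \<le> (lap (c, i) s)\<^sup>2" by (simp add: abs_le_square_iff)
        then show ?case by (simp add: power2_eq_square)
      qed
    qed
    finally show ?thesis .
  qed
  then show "bdd_above ((\<lambda>x. L2_norm P (L2_derivs P {c..} i (\<lambda>x. lap (x, 0)) x)) ` {c..})"
    by (intro bdd_aboveI2[of _ _ "L2_norm P (lap (c, i))"]) auto
qed

end

section \<open>Certificates for the Laplace kernel\<close>

text \<open>Here \<open>N\<close> also becomes the number of interpolation conditions. The disjunct
  \<open>infinite\<close> is needed because \<open>card\<close> is 0 on infinite sets.\<close>

locale laplace_kernel_large_support = laplace_kernel +
  assumes supp: "infinite (measure_supp P) \<or> card (measure_supp P) \<ge> N"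
    and N_pos: "N > 0"
begin

lemma measure_supp_subset:
  assumes "finite Z" "AE s in P. s \<in> Z"
  shows "measure_supp P \<subseteq> Z"
proof
  fix s assume s: "s \<in> measure_supp P"
  show "s \<in> Z"
  proof (rule ccontr)
    assume "s \<notin> Z"
    have op: "open (- Z)" using assms(1) by (simp add: finite_imp_closed open_Compl)
    then have "- Z \<inter> space P \<in> sets P"
      unfolding sets_P sets_restrict_space by (auto simp: Int_commute)
    then have "emeasure P (- Z \<inter> space P) = 0"
      using AE_iff_measurable[of "- Z \<inter> space P" P "\<lambda>s. s \<in> Z"] assms(2) by auto
    then show False using s op \<open>s \<notin> Z\<close> unfolding measure_supp_def by force
  qed
qed

text \<open>Linear independence in \<open>L2\<close>: a nontrivial combination has fewer than
  \<open>N\<close> zeros, and a measure carried by them would have too small a support. The negation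
  \<open>uminus\<close> translates zeros in t to zeros in s = -t.\<close>

lemma lap_span_AE_zero:
  assumes T: "finite T" "down_closed T" "card T \<le> N"
    and zero: "AE s in P. (\<Sum>i\<in>T. b i * lap i s) = 0"
  shows "\<forall>i\<in>T. b i = 0"
proof (rule ccontr)
  assume "\<not> ?thesis"
  then obtain i0 where i0: "i0 \<in> T" "b i0 \<noteq> 0" by blast
  define Z where "Z = {t. (\<Sum>i\<in>T. b i * monom_exp i t) = 0}"
  have Z: "finite Z" "card Z < card T"
    using monom_exp_span_zero_set[where b = b, OF T(1,2) i0] by (auto simp: Z_def)
  have "measure_supp P \<subseteq> uminus ` Z"
  proof (rule measure_supp_subset)
    show "AE s in P. s \<in> uminus ` Z"
      using zero by eventually_elim (force simp: Z_def lap_def image_iff)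
  qed (use Z in simp)
  moreover have "card (uminus ` Z) < N" using Z T(3) card_image_le[of Z uminus] by simp
  ultimately show False
    using supp Z(1) by (meson card_mono finite_imageI finite_subset le_trans not_less)
qed

text \<open>An interpolant in the span of its \<open>N\<close> conditions cannot satisfy one more.
  The index \<open>i\<close> covers both ways in which 1 - eta could have an excess zero: order 0 at
  a new node, or the next order at an old one. The value \<open>0 ^ snd j\<close> is 1 for order 0
  and 0 otherwise, hence equals \<open>monom_exp j 0\<close>. The proof works in the variable t =
  -s, so the measure lives on t < 0.\<close>

lemma moment_neq:
  assumes T: "finite T" "down_closed T" "card T = N" "\<And>j. j \<in> T \<Longrightarrow> c \<le> fst j \<and> snd j \<le> N"
    and i: "i \<notin> T" "down_closed (insert i T)" "c \<le> fst i" "snd i \<le> N"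
    and p: "p \<in> L2 P" "AE s in P. p s = (\<Sum>j\<in>T. b j * lap j s)"
    and mom: "\<And>j. j \<in> T \<Longrightarrow> L2_inner P (lap j) p = 0 ^ snd j"
  shows "L2_inner P (lap i) p \<noteq> 0 ^ snd i"
proof
  assume eq: "L2_inner P (lap i) p = 0 ^ snd i"
  define q where "q t = (\<Sum>j\<in>T. b j * monom_exp j t)" for t
  have pq: "AE s in P. p s = q (- s)" using p(2) by (simp add: q_def lap_def)
  \<comment> \<open>If all coefficients vanished, so would \<open>p\<close>, but some condition of
    order 0 prescribes the value 1.\<close>
  have "\<exists>j\<in>T. b j \<noteq> 0"
  proof (rule ccontr)
    assume "\<not> ?thesis"
    then have "AE s in P. p s = 0" using p(2) by simp
    then have "L2_inner P (lap j) p = 0" if "j \<in> T" for j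
      using L2_inner_cong_AE[of "lap j" P "lap j" p "\<lambda>s. 0"] lap_L2[of j] T(4)[OF that] p(1)
      by (simp add: L2_zero L2_inner_def)
    moreover obtain l k where "(l, k) \<in> T" using T(3) N_pos by (cases "T = {}") auto
    then have "(l, 0) \<in> T" using T(2) unfolding down_closed_def by blast
    ultimately show False using mom[of "(l, 0)"] by simp
  qed
  then obtain j0 where j0: "j0 \<in> T" "b j0 \<noteq> 0" by blast
  define Z where "Z = {t. q t = 0} \<inter> {..<0}"
  have Z0: "finite {t. q t = 0}" "card {t. q t = 0} < N"
    using monom_exp_span_zero_set[where b = b, OF T(1,2) j0] T(3) by (auto simp: q_def)
  have Z: "finite Z" using Z0(1) by (simp add: Z_def)
  have cardZ: "card Z < N" using Z0 card_mono[of "{t. q t = 0}" Z] by (simp add: Z_def)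
  have qcont: "continuous_on {..<0} q"
    unfolding q_def[abs_def] monom_exp_def by (intro continuous_intros)
  have "\<exists>Y\<subseteq>Z. \<exists>e. e \<noteq> 0 \<and> (\<forall>t<0. e * q t * (\<Prod>y\<in>Y. t - y) \<ge> 0)"
    by (rule sign_change_set[OF Z qcont]) (auto simp: Z_def)
  then obtain Y e where Y: "Y \<subseteq> Z" and e: "e \<noteq> 0" "\<And>t. t < 0 \<Longrightarrow> e * q t * (\<Prod>y\<in>Y. t - y) \<ge> 0"
    by blast
  have finY: "finite Y" using Y Z finite_subset by blast
  have cardY: "card Y < N" using card_mono[OF Z Y] cardZ by simp
  \<comment> \<open>The padding points 0, 1, 2, ... bring the total to \<open>N\<close>. Since
    \<open>card Y < N\<close>, at least the point 0 is among them; it will give g(0) = 0.\<close>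
  define E where "E = real ` {..<N - card Y}"
  define W where "W = Y \<union> E"
  have E: "finite E" "card E = N - card Y" "0 \<in> E" "\<And>x. x \<in> E \<Longrightarrow> 0 \<le> x"
    using cardY by (auto simp: E_def card_image image_iff)
  have YE: "Y \<inter> E = {}" using Y E(4) by (force simp: Z_def)
  have W: "finite W" "card W = N" "0 \<in> W"
    using finY E cardY YE by (auto simp: W_def card_Un_disjoint)
  define T' where "T' = insert i T"
  have T': "finite T'" "card T' = Suc N" using T i by (auto simp: T'_def)
  \<comment> \<open>There are \<open>N\<close> equations for \<open>N + 1\<close> unknowns.\<close>
  have "\<exists>d. (\<exists>j\<in>T'. d j \<noteq> 0) \<and> (\<forall>w\<in>W. (\<Sum>j\<in>T'. d j * monom_exp j w) = 0)"
    by (rule homogeneous_system_nontrivial) (use W T' in auto)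
  then obtain d j1 where d: "j1 \<in> T'" "d j1 \<noteq> 0" "\<And>w. w \<in> W \<Longrightarrow> (\<Sum>j\<in>T'. d j * monom_exp j w) = 0"
    by blast
  define g where "g t = (\<Sum>j\<in>T'. d j * monom_exp j t)" for t
  \<comment> \<open>The \<open>N\<close> points of \<open>W\<close> exhaust this bound:
    \<open>g\<close> has no other zeros, and its zeros in \<open>W\<close> are simple.\<close>
  have count: "card A + card B < Suc N" if "finite A" "B \<subseteq> A" "\<forall>t\<in>A. g t = 0" "\<forall>t\<in>B. deriv g t = 0" for A B
    using monom_exp_span_zeros[where b = d, OF T'(1) _ d(1,2) that(1,2)] that(3,4) i(2) T'(2)
    unfolding g_def[abs_def] T'_def by simp
  have gW: "g w = 0" if "w \<in> W" for w using d(3)[OF that] by (simp add: g_def)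
  have g_nz: "g t \<noteq> 0" if "t \<notin> W" for t
    using count[of "insert t W" "{}"] W gW that by auto
  have g'_nz: "deriv g w \<noteq> 0" if "w \<in> W" for w
    using count[of W "{w}"] W gW that by auto
  have gdiff: "(g has_real_derivative deriv g t) (at t)" for t
    unfolding g_def[abs_def] by (rule monom_exp_span_has_derivative)
  have gcont: "continuous_on UNIV g"
    using gdiff by (meson DERIV_isCont continuous_at_imp_continuous_on)
  have glim: "((\<lambda>x. g x / (x - w) ^ 1) \<longlongrightarrow> deriv g w) (at w within UNIV)" if "w \<in> W" for w
    using gdiff[of w] gW[OF that] by (simp add: has_field_derivative_iff)
  have g_all: "\<forall>x\<in>UNIV - W. g x \<noteq> 0" "\<forall>w\<in>W. deriv g w \<noteq> 0" using g_nz g'_nz by auto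
  obtain e2 where e2: "\<And>x. x \<in> UNIV - W \<Longrightarrow> e2 * g x * (\<Prod>w\<in>W. (x - w) ^ 1) > 0"
    by (rule constant_sign_up_to_zeros[OF connected_UNIV gcont W(1) g_all glim], assumption, rule that)
  \<comment> \<open>For t < 0 each factor \<open>t - x\<close> with \<open>x\<close> in
    \<open>E\<close> is negative, which contributes the power of -1.\<close>
  define K where "K = e * e2 * (-1) ^ card E"
  have K: "K * (g t * q t) \<ge> 0" "g t * q t = 0 \<Longrightarrow> q t = 0" if t: "t < 0" for t
  proof -
    \<comment> \<open>A zero of \<open>g\<close> on t < 0 lies in \<open>Y\<close>, and there
      \<open>q\<close> vanishes as well.\<close>
    show "q t = 0" if "g t * q t = 0"
    proof (rule ccontr)
      assume nz: "q t \<noteq> 0"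
      then have "t \<in> W" using that g_nz by auto
      then have "t \<in> Y" using t E(4) by (force simp: W_def)
      then show False using Y nz by (auto simp: Z_def)
    qed
    show "K * (g t * q t) \<ge> 0"
    proof (cases "t \<in> W")
      case False
      define r where "r = (\<Prod>x\<in>E. x - t)"
      define y where "y = (\<Prod>y\<in>Y. t - y)"
      have "r > 0" unfolding r_def using E(4) t by (intro prod_pos) force
      have "y \<noteq> 0" unfolding y_def using finY False by (auto simp: W_def)
      have "(\<Prod>x\<in>E. t - x) = (\<Prod>x\<in>E. - (x - t))" by simp
      also have "\<dots> = (-1) ^ card E * r" unfolding r_def by (rule prod_uminus)
      finally have "(\<Prod>w\<in>W. t - w) = y * ((-1) ^ card E * r)"
        unfolding W_def y_def using finY E(1) YE by (simp add: prod.union_disjoint)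
      then have "0 < e2 * g t * (y * ((-1) ^ card E * r))" using e2[of t] False by simp
      then have "0 \<le> (e * q t * y) * (e2 * g t * (y * ((-1) ^ card E * r)))"
        by (intro mult_nonneg_nonneg[OF e(2)[OF t, folded y_def] less_imp_le])
      also have "\<dots> = (K * (g t * q t)) * (y\<^sup>2 * r)"
        by (simp add: K_def power2_eq_square algebra_simps)
      finally have "0 \<le> (K * (g t * q t)) * (y\<^sup>2 * r)" .
      moreover have "y\<^sup>2 * r > 0" using \<open>r > 0\<close> \<open>y \<noteq> 0\<close> by simp
      ultimately show ?thesis using mult_neg_pos[of "K * (g t * q t)" "y\<^sup>2 * r"] by linarith
    qed (simp add: gW)
  qed
  have K_nz: "K \<noteq> 0"
  proof -
    obtain x where "x \<notin> W" using ex_new_if_finite[OF infinite_UNIV_char_0 W(1)] by blast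
    then have "e2 \<noteq> 0" using e2[of x] by auto
    then show ?thesis using e(1) by (simp add: K_def)
  qed
  have lapL2: "lap j \<in> L2 P" if "j \<in> T'" for j
    using that T(4)[of j] i(3,4) by (cases "j = i") (auto simp: T'_def intro!: lap_L2)
  have "L2_inner P (\<lambda>s. \<Sum>j\<in>T'. d j * lap j s) p = (\<Sum>j\<in>T'. d j * L2_inner P (lap j) p)"
    by (rule L2_inner_sum_left[OF lapL2 p(1)])
  \<comment> \<open>The prescribed moments are the values at 0 of the corresponding
    \<open>monom_exp\<close>, so integrating \<open>g\<close> against \<open>p\<close> amounts to
    evaluation at 0.\<close>
  also have "\<dots> = g 0"
    unfolding g_def monom_exp_0 using mom eq by (intro sum.cong) (auto simp: T'_def)
  also have "\<dots> = 0" using gW W(3) by blast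
  finally have int0: "(LINT s|P. g (- s) * p s) = 0" by (simp add: L2_inner_def g_def lap_def)
  have intg: "integrable P (\<lambda>s. g (- s) * p s)"
    using L2_integrable_mult[OF L2_sum[OF lapL2, of T' "\<lambda>j. j" d] p(1)] by (simp add: g_def lap_def)
  have "AE s in P. K * (g (- s) * p s) \<ge> 0"
    using pq AE_pos
  proof eventually_elim
    case (elim s)
    then show ?case using K(1)[of "- s"] by simp
  qed
  moreover have "(LINT s|P. K * (g (- s) * p s)) = 0" using int0 by simp
  ultimately have "AE s in P. K * (g (- s) * p s) = 0"
    using integral_nonneg_eq_0_iff_AE[of P "\<lambda>s. K * (g (- s) * p s)"] intg by simp
  \<comment> \<open>A function of constant sign with integral 0 vanishes almost everywhere, and with
    it \<open>q (- s)\<close>. This contradicts linear independence.\<close>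
  then have "AE s in P. (\<Sum>j\<in>T. b j * lap j s) = 0"
    using pq AE_pos
  proof eventually_elim
    case (elim s)
    then have "q (- s) = 0" using K(2)[of "- s"] K_nz by (metis mult_eq_0_iff neg_less_0_iff_less)
    then show ?case by (simp add: q_def lap_def)
  qed
  from lap_span_AE_zero[OF T(1,2) _ this] j0 T(3) show False by simp
qed

text \<open>The Gram matrix of the \<open>lap j\<close> is injective by linear independence, so some
  \<open>h b\<close> in their span meets the conditions. Any other solution differs from
  \<open>h b\<close> by an element orthogonal to the span; by Pythagoras the minimizer is unique
  almost everywhere, whichever one \<open>arg_min\<close> selects.\<close>

lemma min_norm_interpolant:
  fixes y :: "real \<times> nat \<Rightarrow> real"
  assumes T: "finite T" "down_closed T" "card T \<le> N" "\<And>j. j \<in> T \<Longrightarrow> c \<le> fst j \<and> snd j \<le> N"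
  defines "Q \<equiv> \<lambda>p. p \<in> L2 P \<and> (\<forall>j\<in>T. L2_inner P (lap j) p = y j)"
  shows "Q (arg_min (L2_norm P) Q) \<and>
    (\<exists>b. AE s in P. arg_min (L2_norm P) Q s = (\<Sum>j\<in>T. b j * lap j s))"
proof -
  have lapL2: "lap j \<in> L2 P" if "j \<in> T" for j using T(4)[OF that] by (intro lap_L2) auto
  define h where "h b s = (\<Sum>j\<in>T. b j * lap j s)" for b s
  have hL2: "h b \<in> L2 P" for b unfolding h_def[abs_def] by (rule L2_sum) (rule lapL2)
  have inner_h: "L2_inner P (h b) p = (\<Sum>j\<in>T. b j * L2_inner P (lap j) p)" if "p \<in> L2 P" for b p
    unfolding h_def[abs_def] by (rule L2_inner_sum_left[OF lapL2 that])
  have h_inner: "L2_inner P (lap i) (h b) = (\<Sum>j\<in>T. b j * L2_inner P (lap i) (lap j))" if "i \<in> T" for i b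
    using inner_h[OF lapL2[OF that]] by (simp add: L2_inner_commute)
  have "\<exists>b. \<forall>i\<in>T. (\<Sum>j\<in>T. b j * L2_inner P (lap i) (lap j)) = y i"
  proof (rule square_system_solvable[OF T(1) T(1) refl])
    fix b assume "\<forall>i\<in>T. (\<Sum>j\<in>T. b j * L2_inner P (lap i) (lap j)) = 0"
    then have "L2_inner P (h b) (h b) = 0" unfolding inner_h[OF hL2] using h_inner by simp
    then have "AE s in P. h b s = 0" by (intro L2_norm_eq_0 hL2) (simp add: L2_norm_def)
    then show "\<forall>j\<in>T. b j = 0" unfolding h_def by (rule lap_span_AE_zero[OF T(1-3)])
  qed
  then obtain b where b: "\<And>i. i \<in> T \<Longrightarrow> L2_inner P (lap i) (h b) = y i" using h_inner by metis
  have Qh: "Q (h b)" unfolding Q_def using hL2 b by simp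
  have pyth: "L2_inner P p p = L2_inner P (h b) (h b) + L2_inner P (\<lambda>s. p s - h b s) (\<lambda>s. p s - h b s)"
    if "Q p" for p
  proof -
    have p: "p \<in> L2 P" using that by (simp add: Q_def)
    have d: "(\<lambda>s. p s - h b s) \<in> L2 P" by (rule L2_diff[OF p hL2])
    have hp: "L2_inner P (h b) p = L2_inner P (h b) (h b)"
      unfolding inner_h[OF p] inner_h[OF hL2] using that b by (simp add: Q_def)
    have "L2_inner P (\<lambda>s. p s - h b s) (\<lambda>s. p s - h b s) =
      L2_inner P (\<lambda>s. p s - h b s) p - L2_inner P (\<lambda>s. p s - h b s) (h b)"
      by (simp add: L2_inner_diff_left[OF p hL2 d] L2_inner_commute[of P "\<lambda>s. p s - h b s"])
    then show ?thesis
      by (simp add: L2_inner_diff_left[OF p hL2] p hL2 hp L2_inner_commute[of P p "h b"])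
  qed
  show ?thesis
  proof (rule arg_minI[of Q, OF Qh])
    fix p assume "Q p"
    then show "\<not> L2_norm P p < L2_norm P (h b)"
      using pyth L2_inner_self_nonneg[of P "\<lambda>s. p s - h b s"] by (simp add: L2_norm_def)
  next
    fix p assume p: "Q p" "\<forall>q. Q q \<longrightarrow> \<not> L2_norm P q < L2_norm P p"
    then have "L2_norm P p \<le> L2_norm P (h b)" using Qh by force
    then have "L2_norm P (\<lambda>s. p s - h b s) = 0"
      using pyth[OF p(1)] L2_inner_self_nonneg[of P "\<lambda>s. p s - h b s"] by (simp add: L2_norm_def)
    moreover have "(\<lambda>s. p s - h b s) \<in> L2 P" using p(1) by (intro L2_diff hL2) (simp add: Q_def)
    ultimately have "AE s in P. p s - h b s = 0" by (intro L2_norm_eq_0)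
    then have "AE s in P. p s = h b s" by eventually_elim simp
    then show "Q p \<and> (\<exists>b. AE s in P. p s = (\<Sum>j\<in>T. b j * lap j s))" using p(1) unfolding h_def by blast
  qed
qed

text \<open>In the Taylor expansion at \<open>z\<close> the terms below order \<open>n\<close> add
  up to 1. Only the Lagrange remainder is left, and its coefficient converges because the derivative
  of order \<open>n\<close> is continuous.\<close>

lemma taylor_quotient_tendsto:
  assumes p: "p \<in> L2 P" and z: "c < z" and n: "0 < n" "n \<le> N"
    and mom: "\<And>k. k < n \<Longrightarrow> L2_inner P (lap (z, k)) p = 0 ^ k"
  shows "((\<lambda>x. (1 - L2_inner P (lap (x, 0)) p) / (x - z) ^ n) \<longlongrightarrow> - L2_inner P (lap (z, n)) p / fact n)
    (at z within {c..})"
proof (rule tendstoI)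
  fix \<epsilon> :: real assume e: "\<epsilon> > 0"
  define f where "f k x = L2_inner P (lap (x, k)) p" for k x
  \<comment> \<open>Taylor's theorem needs two-sided derivatives, so the expansion is done on
    \<open>{a..z + 1}\<close>, away from the boundary point \<open>c\<close>.\<close>
  define a where "a = (c + z) / 2"
  have a: "c < a" "a < z" using z by (auto simp: a_def)
  have "continuous_on {c..} (\<lambda>x. - f n x / fact n)"
    unfolding f_def by (intro continuous_intros L2_continuous_on_inner[OF lap_L2_continuous p] n) simp
  then obtain \<delta> where \<delta>: "\<delta> > 0" "\<And>t. t \<in> {c..} \<Longrightarrow> dist t z < \<delta> \<Longrightarrow> dist (- f n t / fact n) (- f n z / fact n) < \<epsilon>"
    using z e unfolding continuous_on_iff by (metis atLeast_iff less_imp_le)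
  define r where "r = min \<delta> (min 1 (z - a))"
  have "r > 0" using \<delta>(1) a by (simp add: r_def)
  have "dist ((1 - f 0 x) / (x - z) ^ n) (- f n z / fact n) < \<epsilon>" if x: "x \<noteq> z" "dist x z < r" for x
  proof -
    have "\<exists>t. (if x < z then x < t \<and> t < z else z < t \<and> t < x) \<and>
        f 0 x = (\<Sum>m<n. f m z / fact m * (x - z) ^ m) + f n t / fact n * (x - z) ^ n"
    proof (rule Taylor[where a=a and b="z + 1"])
      show "\<forall>m t. m < n \<and> a \<le> t \<and> t \<le> z + 1 \<longrightarrow> DERIV (f m) t :> f (Suc m) t"
      proof (intro allI impI)
        fix m t assume "m < n \<and> a \<le> t \<and> t \<le> z + 1"
        then have m: "m < N" and t: "c < t" using n a by auto
        have "(f m has_real_derivative f (Suc m) t) (at t within {c..})"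
          unfolding f_def by (rule inner_lap_has_derivative[OF m less_imp_le[OF t] p])
        moreover have "at t within {c..} = at t"
          using t by (intro at_within_interior) (simp add: interior_real_atLeast)
        ultimately show "DERIV (f m) t :> f (Suc m) t" by (simp only:)
      qed
      show "f 0 = f 0" "0 < n" "a \<le> z" "z \<le> z + 1" "a \<le> x" "x \<le> z + 1" "x \<noteq> z"
        using n(1) a x by (auto simp: r_def dist_real_def)
    qed
    then obtain t where t: "if x < z then x < t \<and> t < z else z < t \<and> t < x"
      "f 0 x = (\<Sum>m<n. f m z / fact m * (x - z) ^ m) + f n t / fact n * (x - z) ^ n" by blast
    have "(\<Sum>m<n. f m z / fact m * (x - z) ^ m) = (\<Sum>m<n. if m = 0 then 1 else 0)"
      using mom by (intro sum.cong) (auto simp: f_def)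
    also have "\<dots> = 1" using n by (simp add: sum.delta)
    finally have "(1 - f 0 x) / (x - z) ^ n = - f n t / fact n"
      using t(2) x(1) by (simp add: field_simps)
    moreover have "t \<in> {c..}" "dist t z < \<delta>"
      using t(1) x a by (auto simp: dist_real_def r_def split: if_splits)
    ultimately show ?thesis using \<delta>(2) by simp
  qed
  then show "\<forall>\<^sub>F x in at z within {c..}. dist ((1 - L2_inner P (lap (x, 0)) p) / (x - z) ^ n)
      (- L2_inner P (lap (z, n)) p / fact n) < \<epsilon>"
    using \<open>r > 0\<close> unfolding eventually_at f_def by blast
qed

text \<open>Both precertificates at once: \<open>n = 2\<close> with the \<open>M\<close> nodes, and
  \<open>n = 2 * M\<close> with a single node. By \<open>moment_neq\<close>, 1 - eta has no zeros
  outside \<open>Z\<close> and zeros of order exactly \<open>n\<close> on \<open>Z\<close>. As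
  \<open>n\<close> is even, its sign is constant off \<open>Z\<close>, and the limit 1 at infinity
  makes it positive.\<close>

lemma certificate_shape:
  assumes Z: "finite Z" "Z \<subseteq> {c<..}" and n: "even n" "n * card Z = N"
  defines "p \<equiv> arg_min (L2_norm P) (\<lambda>p. p \<in> L2 P \<and> (\<forall>j\<in>Z \<times> {..<n}. L2_inner P (lap j) p = 0 ^ snd j))"
  shows "p \<in> L2 P" "\<forall>z\<in>Z. L2_inner P (lap (z, n)) p < 0"
    "\<forall>y\<in>{c..} - Z. L2_inner P (lap (y, 0)) p < 1"
proof -
  define T where "T = Z \<times> {..<n}"
  have n0: "0 < n" "0 < card Z" using n N_pos by auto
  then have nN: "n \<le> N" using n(2) by (metis One_nat_def Suc_leI mult.right_neutral mult_le_mono2)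
  have T: "finite T" "down_closed T" "card T = N"
    using Z n(2) by (auto simp: T_def down_closed_def mult.commute[of n])
  have T4: "c \<le> fst j \<and> snd j \<le> N" if "j \<in> T" for j
    using that Z(2) nN by (auto simp: T_def)
  have p: "p \<in> L2 P" "\<And>j. j \<in> T \<Longrightarrow> L2_inner P (lap j) p = 0 ^ snd j"
    and "\<exists>b. AE s in P. p s = (\<Sum>j\<in>T. b j * lap j s)"
    using min_norm_interpolant[OF T(1,2) _ T4, of "\<lambda>j. 0 ^ snd j"] T(3) unfolding p_def T_def by auto
  then obtain b where b: "AE s in P. p s = (\<Sum>j\<in>T. b j * lap j s)" by blast
  show "p \<in> L2 P" by (rule p)
  define f where "f x = 1 - L2_inner P (lap (x, 0)) p" for x
  define A where "A z = - L2_inner P (lap (z, n)) p / fact n" for z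
  have fnz: "\<forall>x\<in>{c..} - Z. f x \<noteq> 0"
  proof
    fix x assume x: "x \<in> {c..} - Z"
    then have "down_closed (insert (x, 0) T)" by (auto simp: T_def down_closed_def)
    from moment_neq[OF T T4 _ this _ _ p(1) b p(2)] x show "f x \<noteq> 0"
      by (auto simp: f_def T_def)
  qed
  have Anz: "\<forall>z\<in>Z. A z \<noteq> 0"
  proof
    fix z assume z: "z \<in> Z"
    then have "down_closed (insert (z, n) T)" by (auto simp: T_def down_closed_def)
    from moment_neq[OF T T4 _ this _ _ p(1) b p(2)] z Z(2) nN n0 show "A z \<noteq> 0"
      by (auto simp: A_def T_def)
  qed
  have fcont: "continuous_on {c..} f" unfolding f_def
    by (intro continuous_intros L2_continuous_on_inner[OF lap_L2_continuous p(1)]) simp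
  have flim: "((\<lambda>x. f x / (x - z) ^ n) \<longlongrightarrow> A z) (at z within {c..})" if "z \<in> Z" for z
    unfolding f_def A_def
    by (rule taylor_quotient_tendsto[OF p(1)]) (use that Z n0 nN p(2) in \<open>auto simp: T_def\<close>)
  obtain e where e: "\<And>x. x \<in> {c..} - Z \<Longrightarrow> e * f x * (\<Prod>z\<in>Z. (x - z) ^ n) > 0"
      "\<And>z. z \<in> {c..} \<inter> Z \<Longrightarrow> e * A z * (\<Prod>y\<in>Z - {z}. (z - y) ^ n) > 0"
    by (rule constant_sign_up_to_zeros[OF connected_Ici fcont Z(1) fnz Anz flim], assumption, rule that)
  have nonneg: "(\<Prod>y\<in>Y. (x - y) ^ n) \<ge> 0" for x and Y :: "real set"
    using n(1) by (intro prod_nonneg) (simp add: zero_le_even_power)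
  have "e > 0"
  proof -
    have "\<forall>\<^sub>F x in at_top. L2_inner P (lap (x, 0)) p < 1"
      by (rule order_tendstoD(2)[OF inner_lap_tendsto_0[OF p(1)]]) simp
    moreover have "\<forall>\<^sub>F x in at_top. x > Max Z" "\<forall>\<^sub>F x in at_top. c \<le> x"
      by (rule eventually_gt_at_top eventually_ge_at_top)+
    \<comment> \<open>The sign is read off at a single large x, beyond all nodes.\<close>
    ultimately have "\<forall>\<^sub>F x::real in at_top. e > 0"
    proof eventually_elim
      case (elim x)
      then have "x \<notin> Z" using Max_ge[OF Z(1)] by fastforce
      then have "e * f x * (\<Prod>z\<in>Z. (x - z) ^ n) > 0" "f x > 0" using e(1)[of x] elim by (auto simp: f_def)
      then show ?case using nonneg[of x Z] by (auto simp: zero_less_mult_iff)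
    qed
    then show ?thesis by (simp add: eventually_const)
  qed
  show "\<forall>z\<in>Z. L2_inner P (lap (z, n)) p < 0"
  proof
    fix z assume z: "z \<in> Z"
    then have "e * A z * (\<Prod>y\<in>Z - {z}. (z - y) ^ n) > 0" using e(2) Z(2) by force
    then have "A z > 0" using nonneg[of z "Z - {z}"] \<open>e > 0\<close> by (auto simp: zero_less_mult_iff)
    then show "L2_inner P (lap (z, n)) p < 0" by (simp add: A_def divide_less_0_iff)
  qed
  show "\<forall>y\<in>{c..} - Z. L2_inner P (lap (y, 0)) p < 1"
  proof
    fix y assume y: "y \<in> {c..} - Z"
    have "f y > 0" using e(1)[OF y] nonneg[of y Z] \<open>e > 0\<close> by (auto simp: zero_less_mult_iff)
    then show "L2_inner P (lap (y, 0)) p < 1" by (simp add: f_def)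
  qed
qed

section \<open>Transfer to the operators and precertificates of the two notions\<close>

lemma full_rank_span:
  assumes \<tau>: "inj_on \<tau> {1..n}" "down_closed (\<tau> ` {1..n})" "n \<le> N"
    and G: "\<And>b. AE s in P. G b s = (\<Sum>j\<in>{1..n}. b j * lap (\<tau> j) s)"
  shows "full_rank P n G"
  unfolding full_rank_def
proof (intro allI impI)
  fix b b' assume "L2_eq P (G b) (G b')"
  then have eq: "AE s in P. G b s = G b' s" by (simp add: L2_eq_def)
  define d where "d i = (let j = inv_into {1..n} \<tau> i in b j - b' j)" for i
  have d: "d (\<tau> j) = b j - b' j" if "j \<in> {1..n}" for j
    using that \<tau>(1) by (simp add: d_def)
  have span: "(\<Sum>i\<in>\<tau> ` {1..n}. d i * lap i s) =
    (\<Sum>j\<in>{1..n}. b j * lap (\<tau> j) s) - (\<Sum>j\<in>{1..n}. b' j * lap (\<tau> j) s)" for s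
  proof -
    have "(\<Sum>i\<in>\<tau> ` {1..n}. d i * lap i s) = (\<Sum>j\<in>{1..n}. d (\<tau> j) * lap (\<tau> j) s)"
      unfolding sum.reindex[OF \<tau>(1)] comp_def ..
    also have "\<dots> = (\<Sum>j\<in>{1..n}. (b j - b' j) * lap (\<tau> j) s)"
      by (intro sum.cong) (simp_all add: d)
    finally show ?thesis by (simp add: left_diff_distrib sum_subtractf)
  qed
  have "AE s in P. (\<Sum>i\<in>\<tau> ` {1..n}. d i * lap i s) = 0"
    using eq G[of b] G[of b'] unfolding span by eventually_elim simp
  then have "\<forall>i\<in>\<tau> ` {1..n}. d i = 0"
    using \<tau>(2,3) card_image[OF \<tau>(1)] by (intro lap_span_AE_zero) auto
  then show "\<forall>j\<in>{1..n}. b j = b' j" using d by simp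
qed

lemma Phi_adj_lap: "Phi_adj P (\<lambda>x. lap (x, 0)) p = (\<lambda>x. L2_inner P (lap (x, 0)) p)"
  by (simp add: Phi_adj_def fun_eq_iff)

lemma derivs_within_Phi_adj_lap:
  assumes "k \<le> N" "c \<le> x" "p \<in> L2 P"
  shows "derivs_within {c..} k (Phi_adj P (\<lambda>x. lap (x, 0)) p) x = L2_inner P (lap (x, k)) p"
  using derivs_within_inner_lap[OF assms] by (simp only: Phi_adj_lap)

lemma ndsc_at_lap:
  assumes N: "N = 2 * M" and x: "strict_mono_on {1..M} x" "x ` {1..M} \<subseteq> {c<..}"
  shows "ndsc_at P {c..} (\<lambda>x. lap (x, 0)) M x"
proof -
  let ?\<phi> = "\<lambda>x. lap (x, 0)"
  define Z where "Z = x ` {1..M}"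
  \<comment> \<open>This follows the coefficients of \<open>Gamma_op\<close>:
    \<open>2 * i - 1\<close> goes to the value at \<open>x i\<close>, and \<open>2 * i\<close> to
    the derivative there.\<close>
  define \<tau> where "\<tau> j = (x ((j + 1) div 2), (j + 1) mod 2)" for j
  have N2: "2 \<le> N" using N N_pos by simp
  have xc: "c < x i" if "i \<in> {1..M}" for i using x(2) that by blast
  have inj: "inj_on x {1..M}" using x(1) strict_mono_on_imp_inj_on by blast
  have cardZ: "2 * card Z = N" using inj by (simp add: Z_def card_image N)
  have \<tau>_odd: "\<tau> (2 * i - 1) = (x i, 0)" if "i \<ge> 1" for i using that by (simp add: \<tau>_def)
  have \<tau>_even: "\<tau> (2 * i) = (x i, 1)" for i by (simp add: \<tau>_def)
  have \<tau>_img: "\<tau> ` {1..2 * M} = Z \<times> {..<2}"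
  proof
    show "\<tau> ` {1..2 * M} \<subseteq> Z \<times> {..<2}" by (auto simp: \<tau>_def Z_def intro!: imageI)
    show "Z \<times> {..<2} \<subseteq> \<tau> ` {1..2 * M}"
    proof
      fix j :: "real \<times> nat" assume "j \<in> Z \<times> {..<2}"
      then obtain i k where i: "i \<in> {1..M}" "j = (x i, k)" "k < 2" by (auto simp: Z_def)
      then have "j = \<tau> (2 * i - 1) \<or> j = \<tau> (2 * i)"
        using \<tau>_odd[of i] \<tau>_even[of i] by (auto simp: less_2_cases_iff)
      moreover have "2 * i - 1 \<in> {1..2 * M}" "2 * i \<in> {1..2 * M}" using i(1) by auto
      ultimately show "j \<in> \<tau> ` {1..2 * M}" by blast
    qed
  qed
  have "full_rank P (2 * M) (Gamma_op P {c..} ?\<phi> M x)"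
  proof (rule full_rank_span)
    show "inj_on \<tau> {1..2 * M}"
    proof (rule eq_card_imp_inj_on)
      show "card (\<tau> ` {1..2 * M}) = card {1..2 * M}"
        unfolding \<tau>_img using cardZ N by (simp add: card_cartesian_product)
    qed simp
    show "down_closed (\<tau> ` {1..2 * M})" unfolding \<tau>_img by (auto simp: down_closed_def)
    fix b
    have "\<forall>i\<in>{1..M}. AE s in P. lap (x i, 1) s = L2_deriv P {c..} ?\<phi> (x i) s"
    proof
      fix i assume "i \<in> {1..M}"
      then show "AE s in P. lap (x i, 1) s = L2_deriv P {c..} ?\<phi> (x i) s"
        using L2_derivs_lap[of 1 "x i"] xc[of i] N2 by simp
    qed
    \<comment> \<open>Finitely many exceptional null sets are combined into one.\<close>
    then have "AE s in P. \<forall>i\<in>{1..M}. lap (x i, 1) s = L2_deriv P {c..} ?\<phi> (x i) s"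
      by (subst AE_finite_all) auto
    then show "AE s in P. Gamma_op P {c..} ?\<phi> M x b s = (\<Sum>j\<in>{1..2 * M}. b j * lap (\<tau> j) s)"
    proof eventually_elim
      case (elim s)
      have "Gamma_op P {c..} ?\<phi> M x b s =
        (\<Sum>i\<in>{1..M}. b (2 * i - 1) * lap (\<tau> (2 * i - 1)) s + b (2 * i) * lap (\<tau> (2 * i)) s)"
        unfolding Gamma_op_def
      proof (intro sum.cong refl)
        fix i assume i: "i \<in> {1..M}"
        then have "\<tau> (2 * i - 1) = (x i, 0)" by (intro \<tau>_odd) simp
        then show "b (2 * i - 1) * lap (x i, 0) s + b (2 * i) * L2_deriv P {c..} ?\<phi> (x i) s =
          b (2 * i - 1) * lap (\<tau> (2 * i - 1)) s + b (2 * i) * lap (\<tau> (2 * i)) s"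
          using elim i \<tau>_even by metis
      qed
      then show ?case by (simp only: sum_odd_even[where f="\<lambda>j. b j * lap (\<tau> j) s"])
    qed
  qed (simp add: N)
  \<comment> \<open>Once the constraint predicates are equal, both \<open>arg_min\<close> terms
    select the same representative.\<close>
  moreover have "(\<lambda>p. p \<in> L2 P \<and> (\<forall>i\<in>{1..M}. Phi_adj P ?\<phi> p (x i) = 1 \<and>
      derivs_within {c..} 1 (Phi_adj P ?\<phi> p) (x i) = 0)) =
    (\<lambda>p. p \<in> L2 P \<and> (\<forall>j\<in>Z \<times> {..<2}. L2_inner P (lap j) p = 0 ^ snd j))"
  proof (rule ext, rule conj_cong[OF refl])
    fix p assume p: "p \<in> L2 P"
    have "derivs_within {c..} 1 (Phi_adj P ?\<phi> p) (x i) = L2_inner P (lap (x i, 1)) p" if "i \<in> {1..M}" for i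
      using derivs_within_Phi_adj_lap[of 1 "x i" p] N2 xc[OF that] p by simp
    moreover have "{..<2} = {0, 1 :: nat}" by auto
    ultimately show "(\<forall>i\<in>{1..M}. Phi_adj P ?\<phi> p (x i) = 1 \<and>
        derivs_within {c..} 1 (Phi_adj P ?\<phi> p) (x i) = 0) \<longleftrightarrow>
      (\<forall>j\<in>Z \<times> {..<2}. L2_inner P (lap j) p = 0 ^ snd j)"
      unfolding Z_def by (auto simp: Phi_adj_lap)
  qed
  then have pV: "p_V P {c..} ?\<phi> M x =
    arg_min (L2_norm P) (\<lambda>p. p \<in> L2 P \<and> (\<forall>j\<in>Z \<times> {..<2}. L2_inner P (lap j) p = 0 ^ snd j))"
    unfolding p_V_def by simp
  have "finite Z" "Z \<subseteq> {c<..}" using x(2) by (auto simp: Z_def)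
  note cert = certificate_shape[OF this even_numeral cardZ, folded pV]
  have "\<forall>y\<in>{c..} - x ` {1..M}. eta_V P {c..} ?\<phi> M x y < 1"
    using cert(3) by (simp add: eta_V_def Phi_adj_lap Z_def)
  moreover have "derivs_within {c..} 2 (eta_V P {c..} ?\<phi> M x) (x i) < 0" if "i \<in> {1..M}" for i
    unfolding eta_V_def derivs_within_Phi_adj_lap[OF N2 less_imp_le[OF xc[OF that]] cert(1)]
    using cert(2) that by (simp add: Z_def)
  ultimately show ?thesis unfolding ndsc_at_def by blast
qed

lemma non_degenerate_point_lap:
  assumes N: "N = 2 * M" and x: "c < x\<^sub>0"
  shows "non_degenerate_point P {c..} (\<lambda>x. lap (x, 0)) M x\<^sub>0"
proof -
  let ?\<phi> = "\<lambda>x. lap (x, 0)"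
  \<comment> \<open>The shift matches \<open>F_op\<close>, where the derivative of order k carries
    the coefficient \<open>b (k + 1)\<close>.\<close>
  define \<tau> where "\<tau> j = (x\<^sub>0, j - 1)" for j :: nat
  have \<tau>_img: "\<tau> ` {1..2 * M} = {x\<^sub>0} \<times> {..<2 * M}"
    by (auto simp: \<tau>_def image_iff intro!: bexI[of _ "Suc _"])
  have "full_rank P (2 * M) (F_op P {c..} ?\<phi> M x\<^sub>0)"
  proof (rule full_rank_span)
    show "inj_on \<tau> {1..2 * M}" by (auto simp: \<tau>_def inj_on_def)
    show "down_closed (\<tau> ` {1..2 * M})" unfolding \<tau>_img by (auto simp: down_closed_def)
    fix b
    have "\<forall>k\<in>{0..<2 * M}. AE s in P. lap (x\<^sub>0, k) s = L2_derivs P {c..} k ?\<phi> x\<^sub>0 s"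
      using L2_derivs_lap N x by simp
    then have "AE s in P. \<forall>k\<in>{0..<2 * M}. lap (x\<^sub>0, k) s = L2_derivs P {c..} k ?\<phi> x\<^sub>0 s"
      by (subst AE_finite_all) auto
    then show "AE s in P. F_op P {c..} ?\<phi> M x\<^sub>0 b s = (\<Sum>j\<in>{1..2 * M}. b j * lap (\<tau> j) s)"
    proof eventually_elim
      case (elim s)
      have "F_op P {c..} ?\<phi> M x\<^sub>0 b s = (\<Sum>k\<in>{0..<2 * M}. b (Suc k) * lap (\<tau> (Suc k)) s)"
        unfolding F_op_def using elim by (intro sum.cong) (auto simp: \<tau>_def)
      also have "\<dots> = (\<Sum>j\<in>{1..<Suc (2 * M)}. b j * lap (\<tau> j) s)"
        unfolding One_nat_def by (rule sum.shift_bounds_Suc_ivl[symmetric])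
      finally show ?case by (simp only: atLeastLessThanSuc_atLeastAtMost)
    qed
  qed (simp add: N)
  moreover have "(\<lambda>p. p \<in> L2 P \<and> Phi_adj P ?\<phi> p x\<^sub>0 = 1 \<and>
      (\<forall>k\<in>{1..2 * M - 1}. derivs_within {c..} k (Phi_adj P ?\<phi> p) x\<^sub>0 = 0)) =
    (\<lambda>p. p \<in> L2 P \<and> (\<forall>j\<in>{x\<^sub>0} \<times> {..<2 * M}. L2_inner P (lap j) p = 0 ^ snd j))"
  proof (rule ext, rule conj_cong[OF refl])
    fix p assume p: "p \<in> L2 P"
    have "derivs_within {c..} k (Phi_adj P ?\<phi> p) x\<^sub>0 = L2_inner P (lap (x\<^sub>0, k)) p"
      if "k \<in> {1..2 * M - 1}" for k
      by (rule derivs_within_Phi_adj_lap) (use N x p that in auto)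
    moreover have "{..<2 * M} = insert 0 {1..2 * M - 1}" using N N_pos by auto
    ultimately show "Phi_adj P ?\<phi> p x\<^sub>0 = 1 \<and>
        (\<forall>k\<in>{1..2 * M - 1}. derivs_within {c..} k (Phi_adj P ?\<phi> p) x\<^sub>0 = 0) \<longleftrightarrow>
      (\<forall>j\<in>{x\<^sub>0} \<times> {..<2 * M}. L2_inner P (lap j) p = 0 ^ snd j)"
      by (auto simp: Phi_adj_lap)
  qed
  then have pW: "p_W P {c..} ?\<phi> M x\<^sub>0 =
    arg_min (L2_norm P) (\<lambda>p. p \<in> L2 P \<and> (\<forall>j\<in>{x\<^sub>0} \<times> {..<2 * M}. L2_inner P (lap j) p = 0 ^ snd j))"
    unfolding p_W_def by simp
  have "finite {x\<^sub>0}" "{x\<^sub>0} \<subseteq> {c<..}" "even (2 * M)" "2 * M * card {x\<^sub>0} = N" using N x by auto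
  note cert = certificate_shape[OF this, folded pW]
  have "derivs_within {c..} (2 * M) (eta_W P {c..} ?\<phi> M x\<^sub>0) x\<^sub>0 < 0"
    unfolding eta_W_def
    using derivs_within_Phi_adj_lap[of "2 * M" x\<^sub>0, OF _ _ cert(1)] cert(2) N x by simp
  moreover have "\<forall>y\<in>{c..} - {x\<^sub>0}. eta_W P {c..} ?\<phi> M x\<^sub>0 y < 1"
    using cert(3) by (simp add: eta_W_def Phi_adj_lap)
  ultimately show ?thesis unfolding non_degenerate_point_def using lap_admissible N by blast
qed

end

text \<open>Since \<open>space P\<close> is positive, \<open>\<bar>s\<bar>\<close> is s, and the
  exponent \<open>4 * M\<close> is twice the order \<open>2 * M\<close>; finiteness of the
  nonnegative integral then gives integrability.\<close>

lemma laplace_kernel_large_supportI: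
  assumes "M \<ge> 1" and S: "space P \<subseteq> {0<..}" "sets P = sets (restrict_space borel (space P))"
    and fin: "(\<integral>\<^sup>+ s. ennreal ((1 + \<bar>s\<bar>) ^ (4 * M) * exp (- 2 * c * s)) \<partial>P) < \<infinity>"
    and supp: "infinite (measure_supp P) \<or> card (measure_supp P) \<ge> 2 * M"
  shows "laplace_kernel_large_support P c (2 * M)"
proof
  let ?w = "\<lambda>s. (1 + s) ^ (2 * (2 * M)) * exp (- 2 * c * s)"
  have "?w \<in> borel_measurable (restrict_space borel (space P))"
    by (intro measurable_restrict_space1 borel_measurable_continuous_onI continuous_intros)
  then have meas: "?w \<in> borel_measurable P"
    using measurable_cong_sets[OF S(2) refl] by blast
  show "integrable P ?w"
  proof (rule integrableI_nonneg[OF meas])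
    show "AE s in P. 0 \<le> ?w s" by (intro AE_I2 mult_nonneg_nonneg zero_le_even_power) simp_all
    have "(\<integral>\<^sup>+ s. ennreal (?w s) \<partial>P) = (\<integral>\<^sup>+ s. ennreal ((1 + \<bar>s\<bar>) ^ (4 * M) * exp (- 2 * c * s)) \<partial>P)"
      by (rule nn_integral_cong) (use S(1) in auto)
    then show "(\<integral>\<^sup>+ s. ennreal (?w s) \<partial>P) < \<infinity>" using fin by simp
  qed
qed (use assms in auto)

theorem corollary1:
  fixes M :: nat and c :: real and X S :: "real set" and P :: "real measure"
    and \<psi> :: "real \<times> real \<Rightarrow> real"
  assumes "M \<ge> 1"
    and "c \<ge> 0"
    and "X = {c..}"
    and "S \<subseteq> {0<..}" and "is_interval S"
    and "space P = S" and "sets P = sets (restrict_space borel S)"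
    and "(\<integral>\<^sup>+ s. ennreal ((1 + \<bar>s\<bar>) ^ (4 * M) * exp (- 2 * c * s)) \<partial>P) < \<infinity>"
    and "\<psi> = (\<lambda>(x, s). exp (- (x * s)))"
    and "infinite (measure_supp P) \<or> card (measure_supp P) \<ge> 2 * M"
  shows "(\<forall>(a :: nat \<Rightarrow> real) (x :: nat \<Rightarrow> real) m\<^sub>0.
            strict_mono_on {1..M} x \<and> x ` {1..M} \<subseteq> interior X \<and> (\<forall>i\<in>{1..M}. 0 < a i) \<and>
            m\<^sub>0 = dirac_sum X M a x \<longrightarrow>
            non_degenerate_source_condition P X (framework \<psi>) m\<^sub>0) \<and>
         (\<forall>x\<^sub>0\<in>interior X. non_degenerate_point P X (framework \<psi>) M x\<^sub>0)"
proof -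
  interpret laplace_kernel_large_support P c "2 * M"
    by (rule laplace_kernel_large_supportI) (use assms in auto)
  have \<phi>: "framework \<psi> = (\<lambda>x. lap (x, 0))"
    by (simp add: framework_def assms(9) lap_def monom_exp_def fun_eq_iff)
  have int: "interior X = {c<..}" using assms(3) by (simp add: interior_real_atLeast)
  show ?thesis
  proof (intro conjI allI impI ballI)
    fix a x :: "nat \<Rightarrow> real" and m\<^sub>0
    assume H: "strict_mono_on {1..M} x \<and> x ` {1..M} \<subseteq> interior X \<and> (\<forall>i\<in>{1..M}. 0 < a i) \<and>
      m\<^sub>0 = dirac_sum X M a x"
    then have sub: "x ` {1..M} \<subseteq> X" using interior_subset by blast
    have "ndsc_at P X (framework \<psi>) M x"
      unfolding \<phi> assms(3) by (rule ndsc_at_lap) (use H int in auto)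
    \<comment> \<open>The condition depends on the measure only, because its increasing enumeration
      of atoms is unique.\<close>
    then show "non_degenerate_source_condition P X (framework \<psi>) m\<^sub>0"
      using H sub ndsc_dirac_sum_iff[of M x X a P "framework \<psi>"] by simp
  next
    fix x\<^sub>0 assume "x\<^sub>0 \<in> interior X"
    then show "non_degenerate_point P X (framework \<psi>) M x\<^sub>0"
      unfolding \<phi> assms(3) using non_degenerate_point_lap[of M x\<^sub>0] by (simp add: interior_real_atLeast)
  qed
qed
end
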